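(* The first-order theory $VW^+$ interprets the first-order theory $WD_R$ (both defined in the context).
   Context: "Interprets" refers to (relative) formal interpretability in the usual sense. Both theories include the usual axioms for identity. $WD_R$: $B^*$ is the set of nonempty finite strings of 0's and 1's, $^\frown$ is concatenation, and $s\sqsubseteq t$ between strings means $s$ is a (nonempty, possibly improper) initial segment of $t$. The vocabulary has a constant $\underline{s}$ for each $s\in B^*$, a binary relation symbol $\preccurlyeq$ and a ternary relation symbol $C$. Axioms: (1) $C(\underline{s},\underline{t},\underline{s^\frown t})$ for $s,t\in B^*$; (2) $\neg(\underline{s}=\underline{t})$ for distinct $s,t\in B^*$; (3) $\forall x(x\preccurlyeq\underline{t}\leftrightarrow\bigvee_{s\sqsubseteq t}x=\underline{s})$ for $t\in B^*$; (4) $\forall x,y\,\exists z\,C(x,y,z)$; (5) $\forall x,y,u,v\,(C(x,y,u)\ \&\ C(x,y,v)\to u=v)$. $VW^+$: $\Sigma^*$ is the set of finite words over $\{1,2\}$, including the empty word $e$; $lh(s)$ is the length of $s$; $s^{-1}$ its reversal; $2^m$ the string of $m$ consecutive 2's ($2^0=e$). Signature $\{\underline{e},S_1,S_2,f,\sqsubseteq,|{\le}|\}$ ($\underline{e}$ a constant, $S_1,S_2,f$ unary functions, $\sqsubseteq,|{\le}|$ binary relations). The canonical term of $e$ is $\underline{e}$, and $\underline{w^\frown d}$ is $S_d(\underline{w})$ for $d\in\{1,2\}$. Axioms: (VW1) $\neg\,\underline{s}=\underline{t}$ for distinct $s,t\in\Sigma^*$; (VW2) $S_d(\underline{t})=\underline{t^\frown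 d}$ for $t\in\Sigma^*$, $d=1,2$; (VW3) $\underline{e}\sqsubseteq\underline{t}$ for $t\in\Sigma^*$; (VW4) $\forall x(x\sqsubseteq\underline{e}\to x=\underline{e})$; (VW5) $\forall x(x\sqsubseteq S_d(\underline{t})\leftrightarrow x\sqsubseteq\underline{t}\vee x=S_d(\underline{t}))$ for $t\in\Sigma^*$, $d=1,2$; (VW6) $\forall x(x\,|{\le}|\,\underline{2^m}\leftrightarrow\bigvee_{lh(s)\le m}x=\underline{s})$ for $m\ge0$; (VW7) $\exists y\,(y\,|{\le}|\,\underline{t})\to\forall x(x\sqsubseteq\underline{t}\ \&\ x\ne\underline{e}\to\underline{2}\sqsubseteq f(x))$ for $t\in\Sigma^*$; (VW8) $f(\underline{t})=\underline{t^{-1}}$ for $t\in\Sigma^*$; (VW9) $\forall x,y(f(x)=f(y)\to x=y)$; (VW10) $\forall x,y(x\sqsubseteq y\ \&\ y\sqsubseteq x\to x=y)$. *)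

theory Defs
  imports Main "HOL-Library.Sublist"
begin

section \<open>First-order logic with identity\<close>

text \<open>
  A signature assigns arities to the symbols it contains; symbols sent to \<open>None\<close> do not
  belong to it. Variables are de Bruijn indices. Identity is a logical symbol, whose axioms are
  part of the deductive system and hence of every theory.
\<close>

record ('f, 'r) sig =
  fun_arity :: "'f \<Rightarrow> nat option"
  rel_arity :: "'r \<Rightarrow> nat option"

datatype 'f tm = Var nat | Fn 'f "'f tm list"

datatype ('f, 'r) fm =
    Bot
  | Eq "'f tm" "'f tm"  (infix \<open>\<^bold>=\<close> 55)
  | Rel 'r "'f tm list"
  | Imp "('f, 'r) fm" "('f, 'r) fm"  (infixr \<open>\<^bold>\<longrightarrow>\<close> 25)
  | All "('f, 'r) fm"

abbreviation Neg :: "('f, 'r) fm \<Rightarrow> ('f, 'r) fm" where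
  "Neg \<phi> \<equiv> \<phi> \<^bold>\<longrightarrow> Bot"
abbreviation Or :: "('f, 'r) fm \<Rightarrow> ('f, 'r) fm \<Rightarrow> ('f, 'r) fm"  (infixr \<open>\<^bold>\<or>\<close> 30) where
  "\<phi> \<^bold>\<or> \<psi> \<equiv> Neg \<phi> \<^bold>\<longrightarrow> \<psi>"
abbreviation And :: "('f, 'r) fm \<Rightarrow> ('f, 'r) fm \<Rightarrow> ('f, 'r) fm"  (infixr \<open>\<^bold>\<and>\<close> 35) where
  "\<phi> \<^bold>\<and> \<psi> \<equiv> Neg (\<phi> \<^bold>\<longrightarrow> Neg \<psi>)"
abbreviation Iff :: "('f, 'r) fm \<Rightarrow> ('f, 'r) fm \<Rightarrow> ('f, 'r) fm"  (infix \<open>\<^bold>\<longleftrightarrow>\<close> 26) where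
  "\<phi> \<^bold>\<longleftrightarrow> \<psi> \<equiv> (\<phi> \<^bold>\<longrightarrow> \<psi>) \<^bold>\<and> (\<psi> \<^bold>\<longrightarrow> \<phi>)"
abbreviation Exi :: "('f, 'r) fm \<Rightarrow> ('f, 'r) fm" where
  "Exi \<phi> \<equiv> Neg (All (Neg \<phi>))"

definition Disj :: "('f, 'r) fm list \<Rightarrow> ('f, 'r) fm" where
  "Disj \<phi>s = foldr (\<lambda>\<phi> \<psi>. \<phi> \<^bold>\<or> \<psi>) \<phi>s Bot"

definition Conj :: "('f, 'r) fm list \<Rightarrow> ('f, 'r) fm" where
  "Conj \<phi>s = foldr (\<lambda>\<phi> \<psi>. \<phi> \<^bold>\<and> \<psi>) \<phi>s (Neg Bot)"

text \<open>The bound variables of \<open>All_n n \<phi>\<close> and \<open>Exi_n n \<phi>\<close> are the indices below \<open>n\<close> in \<open>\<phi>\<close>.\<close>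

definition All_n :: "nat \<Rightarrow> ('f, 'r) fm \<Rightarrow> ('f, 'r) fm" where
  "All_n n = All ^^ n"

definition Exi_n :: "nat \<Rightarrow> ('f, 'r) fm \<Rightarrow> ('f, 'r) fm" where
  "Exi_n n = (\<lambda>\<phi>. Exi \<phi>) ^^ n"

primrec wf_tm :: "('f, 'r) sig \<Rightarrow> 'f tm \<Rightarrow> bool" where
  "wf_tm \<Sigma> (Var i) \<longleftrightarrow> True"
| "wf_tm \<Sigma> (Fn f ts) \<longleftrightarrow> fun_arity \<Sigma> f = Some (length ts) \<and> list_all (wf_tm \<Sigma>) ts"

primrec wf_fm :: "('f, 'r) sig \<Rightarrow> ('f, 'r) fm \<Rightarrow> bool" where
  "wf_fm \<Sigma> Bot \<longleftrightarrow> True"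
| "wf_fm \<Sigma> (s \<^bold>= t) \<longleftrightarrow> wf_tm \<Sigma> s \<and> wf_tm \<Sigma> t"
| "wf_fm \<Sigma> (Rel r ts) \<longleftrightarrow> rel_arity \<Sigma> r = Some (length ts) \<and> list_all (wf_tm \<Sigma>) ts"
| "wf_fm \<Sigma> (\<phi> \<^bold>\<longrightarrow> \<psi>) \<longleftrightarrow> wf_fm \<Sigma> \<phi> \<and> wf_fm \<Sigma> \<psi>"
| "wf_fm \<Sigma> (All \<phi>) \<longleftrightarrow> wf_fm \<Sigma> \<phi>"

primrec fv_tm :: "'f tm \<Rightarrow> nat set" where
  "fv_tm (Var i) = {i}"
| "fv_tm (Fn f ts) = \<Union> (set (map fv_tm ts))"

primrec fv_fm :: "('f, 'r) fm \<Rightarrow> nat set" where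
  "fv_fm Bot = {}"
| "fv_fm (s \<^bold>= t) = fv_tm s \<union> fv_tm t"
| "fv_fm (Rel r ts) = \<Union> (set (map fv_tm ts))"
| "fv_fm (\<phi> \<^bold>\<longrightarrow> \<psi>) = fv_fm \<phi> \<union> fv_fm \<psi>"
| "fv_fm (All \<phi>) = {i. Suc i \<in> fv_fm \<phi>}"

primrec subst_tm :: "(nat \<Rightarrow> 'f tm) \<Rightarrow> 'f tm \<Rightarrow> 'f tm" where
  "subst_tm \<sigma> (Var i) = \<sigma> i"
| "subst_tm \<sigma> (Fn f ts) = Fn f (map (subst_tm \<sigma>) ts)"

definition lift_subst :: "(nat \<Rightarrow> 'f tm) \<Rightarrow> nat \<Rightarrow> 'f tm" where
  "lift_subst \<sigma> = case_nat (Var 0) (\<lambda>i. subst_tm (\<lambda>j. Var (Suc j)) (\<sigma> i))"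

primrec subst_fm :: "(nat \<Rightarrow> 'f tm) \<Rightarrow> ('f, 'r) fm \<Rightarrow> ('f, 'r) fm" where
  "subst_fm \<sigma> Bot = Bot"
| "subst_fm \<sigma> (s \<^bold>= t) = (subst_tm \<sigma> s \<^bold>= subst_tm \<sigma> t)"
| "subst_fm \<sigma> (Rel r ts) = Rel r (map (subst_tm \<sigma>) ts)"
| "subst_fm \<sigma> (\<phi> \<^bold>\<longrightarrow> \<psi>) = (subst_fm \<sigma> \<phi> \<^bold>\<longrightarrow> subst_fm \<sigma> \<psi>)"
| "subst_fm \<sigma> (All \<phi>) = All (subst_fm (lift_subst \<sigma>) \<phi>)"

abbreviation rename_fm :: "(nat \<Rightarrow> nat) \<Rightarrow> ('f, 'r) fm \<Rightarrow> ('f, 'r) fm" where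
  "rename_fm \<rho> \<equiv> subst_fm (\<lambda>i. Var (\<rho> i))"

text \<open>Instantiation of the outermost variable of the body of a quantifier.\<close>

definition inst :: "('f, 'r) fm \<Rightarrow> 'f tm \<Rightarrow> ('f, 'r) fm" where
  "inst \<phi> t = subst_fm (case_nat t Var) \<phi>"

text \<open>
  Natural deduction for classical first-order logic with identity. Derivations only use
  formulas over \<open>\<Sigma>\<close>. In \<open>AllI\<close> the shift makes variable 0 fresh for the assumptions.
\<close>

inductive deriv :: "('f, 'r) sig \<Rightarrow> ('f, 'r) fm set \<Rightarrow> ('f, 'r) fm \<Rightarrow> bool" for \<Sigma> where
  Asm: "\<phi> \<in> \<Gamma> \<Longrightarrow> deriv \<Sigma> \<Gamma> \<phi>"
| ImpI: "wf_fm \<Sigma> \<phi> \<Longrightarrow> deriv \<Sigma> (insert \<phi> \<Gamma>) \<psi> \<Longrightarrow> deriv \<Sigma> \<Gamma> (\<phi> \<^bold>\<longrightarrow> \<psi>)"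
| ImpE: "deriv \<Sigma> \<Gamma> (\<phi> \<^bold>\<longrightarrow> \<psi>) \<Longrightarrow> deriv \<Sigma> \<Gamma> \<phi> \<Longrightarrow> deriv \<Sigma> \<Gamma> \<psi>"
| Raa: "wf_fm \<Sigma> \<phi> \<Longrightarrow> deriv \<Sigma> (insert (Neg \<phi>) \<Gamma>) Bot \<Longrightarrow> deriv \<Sigma> \<Gamma> \<phi>"
| AllI: "deriv \<Sigma> (rename_fm Suc ` \<Gamma>) \<phi> \<Longrightarrow> deriv \<Sigma> \<Gamma> (All \<phi>)"
| AllE: "deriv \<Sigma> \<Gamma> (All \<phi>) \<Longrightarrow> wf_tm \<Sigma> t \<Longrightarrow> deriv \<Sigma> \<Gamma> (inst \<phi> t)"
| EqRefl: "wf_tm \<Sigma> t \<Longrightarrow> deriv \<Sigma> \<Gamma> (t \<^bold>= t)"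
| EqSubst: "wf_fm \<Sigma> \<phi> \<Longrightarrow> deriv \<Sigma> \<Gamma> (s \<^bold>= t) \<Longrightarrow> deriv \<Sigma> \<Gamma> (inst \<phi> s) \<Longrightarrow> deriv \<Sigma> \<Gamma> (inst \<phi> t)"


section \<open>Relative interpretability\<close>

text \<open>
  A translation consists of a domain formula in the variable 0, for each \<open>n\<close>-ary relation symbol
  a formula in the variables \<open>0, \<dots>, n - 1\<close>, and for each \<open>n\<close>-ary function symbol a formula in
  \<open>0, \<dots>, n\<close> for its graph, where \<open>n\<close> stands for the value.
  Translations are one-dimensional and parameter-free and leave identity unchanged.
\<close>

record ('f, 'r, 'g, 's) translation =
  dom_tr :: "('g, 's) fm"
  fun_tr :: "'f \<Rightarrow> ('g, 's) fm"
  rel_tr :: "'r \<Rightarrow> ('g, 's) fm"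

definition wf_translation ::
  "('f, 'r) sig \<Rightarrow> ('g, 's) sig \<Rightarrow> ('f, 'r, 'g, 's) translation \<Rightarrow> bool" where
  "wf_translation \<Sigma> \<Sigma>' \<tau> \<longleftrightarrow>
     wf_fm \<Sigma>' (dom_tr \<tau>) \<and> fv_fm (dom_tr \<tau>) \<subseteq> {0} \<and>
     (\<forall>f n. fun_arity \<Sigma> f = Some n \<longrightarrow> wf_fm \<Sigma>' (fun_tr \<tau> f) \<and> fv_fm (fun_tr \<tau> f) \<subseteq> {..n}) \<and>
     (\<forall>r n. rel_arity \<Sigma> r = Some n \<longrightarrow> wf_fm \<Sigma>' (rel_tr \<tau> r) \<and> fv_fm (rel_tr \<tau> r) \<subseteq> {..<n})"

definition in_dom :: "('f, 'r, 'g, 's) translation \<Rightarrow> nat \<Rightarrow> ('g, 's) fm" where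
  "in_dom \<tau> i = rename_fm (\<lambda>_. i) (dom_tr \<tau>)"

text \<open>
  In \<open>unnest \<tau> k gs \<psi>\<close> the formula \<open>gs ! i\<close> says that variable 0 is the value of the \<open>i\<close>-th
  argument; its variable \<open>j + 1\<close> is variable \<open>j\<close> of the translated term. Under the new quantifiers,
  these become \<open>i\<close> and \<open>j + k + length gs\<close>: \<open>k\<close> variables are skipped, namely
  one (the value) for function symbols and none for relation symbols.
\<close>

definition unnest ::
  "('f, 'r, 'g, 's) translation \<Rightarrow> nat \<Rightarrow> ('g, 's) fm list \<Rightarrow> ('g, 's) fm \<Rightarrow> ('g, 's) fm" where
  "unnest \<tau> k gs \<psi> =
     Exi_n (length gs)
       (Conj (map (\<lambda>i. in_dom \<tau> i \<^bold>\<and> rename_fm (case_nat i (\<lambda>j. j + k + length gs)) (gs ! i))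
                [0..<length gs])
        \<^bold>\<and> \<psi>)"

primrec tr_tm :: "('f, 'r, 'g, 's) translation \<Rightarrow> 'f tm \<Rightarrow> ('g, 's) fm" where
  "tr_tm \<tau> (Var j) = (Var 0 \<^bold>= Var (Suc j))"
| "tr_tm \<tau> (Fn f ts) = unnest \<tau> 1 (map (tr_tm \<tau>) ts) (fun_tr \<tau> f)"

primrec tr_fm :: "('f, 'r, 'g, 's) translation \<Rightarrow> ('f, 'r) fm \<Rightarrow> ('g, 's) fm" where
  "tr_fm \<tau> Bot = Bot"
| "tr_fm \<tau> (s \<^bold>= t) = unnest \<tau> 0 [tr_tm \<tau> s, tr_tm \<tau> t] (Var 0 \<^bold>= Var 1)"
| "tr_fm \<tau> (Rel r ts) = unnest \<tau> 0 (map (tr_tm \<tau>) ts) (rel_tr \<tau> r)"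
| "tr_fm \<tau> (\<phi> \<^bold>\<longrightarrow> \<psi>) = (tr_fm \<tau> \<phi> \<^bold>\<longrightarrow> tr_fm \<tau> \<psi>)"
| "tr_fm \<tau> (All \<phi>) = All (dom_tr \<tau> \<^bold>\<longrightarrow> tr_fm \<tau> \<phi>)"

text \<open>
  The sentence saying that \<open>\<phi>\<close>, with arguments \<open>0, \<dots>, n - 1\<close> and value \<open>n\<close>, defines an \<open>n\<close>-ary
  operation on the domain. Inside the last two quantifiers, 0 is an arbitrary element of the domain,
  1 is the value, and the arguments are \<open>2, \<dots>, n + 1\<close>.
\<close>

definition functional :: "('f, 'r, 'g, 's) translation \<Rightarrow> nat \<Rightarrow> ('g, 's) fm \<Rightarrow> ('g, 's) fm" where
  "functional \<tau> n \<phi> =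
     All_n n (Conj (map (in_dom \<tau>) [0..<n]) \<^bold>\<longrightarrow>
       Exi (in_dom \<tau> 0 \<^bold>\<and>
         All (in_dom \<tau> 0 \<^bold>\<longrightarrow>
           (rename_fm (\<lambda>i. if i < n then i + 2 else 0) \<phi> \<^bold>\<longleftrightarrow> Var 0 \<^bold>= Var 1))))"

text \<open>\<open>interprets \<Sigma>' S \<Sigma> T\<close>: the theory \<open>S\<close> over \<open>\<Sigma>'\<close> interprets the theory \<open>T\<close> over \<open>\<Sigma>\<close>.\<close>

definition interprets ::
  "('g, 's) sig \<Rightarrow> ('g, 's) fm set \<Rightarrow> ('f, 'r) sig \<Rightarrow> ('f, 'r) fm set \<Rightarrow> bool" where
  "interprets \<Sigma>' S \<Sigma> T \<longleftrightarrow>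
     (\<exists>\<tau> :: ('f, 'r, 'g, 's) translation.
        wf_translation \<Sigma> \<Sigma>' \<tau> \<and>
        deriv \<Sigma>' S (Exi (dom_tr \<tau>)) \<and>
        (\<forall>f n. fun_arity \<Sigma> f = Some n \<longrightarrow> deriv \<Sigma>' S (functional \<tau> n (fun_tr \<tau> f))) \<and>
        (\<forall>\<phi>\<in>T. deriv \<Sigma>' S (tr_fm \<tau> \<phi>)))"


section \<open>The theory \<open>WD\<^sub>R\<close>\<close>

text \<open>The constants are the nonempty bit strings, with \<open>False\<close> for 0 and \<open>True\<close> for 1.\<close>

datatype wd_rel = Wd_le | Wd_C

definition wd_sig :: "(bool list, wd_rel) sig" where
  "wd_sig = \<lparr>fun_arity = (\<lambda>s. if s = [] then None else Some 0),
             rel_arity = (\<lambda>r. case r of Wd_le \<Rightarrow> Some 2 | Wd_C \<Rightarrow> Some 3)\<rparr>"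

abbreviation wd_const :: "bool list \<Rightarrow> bool list tm" where
  "wd_const s \<equiv> Fn s []"

abbreviation wd_le :: "bool list tm \<Rightarrow> bool list tm \<Rightarrow> (bool list, wd_rel) fm" where
  "wd_le x y \<equiv> Rel Wd_le [x, y]"

abbreviation wd_C :: "bool list tm \<Rightarrow> bool list tm \<Rightarrow> bool list tm \<Rightarrow> (bool list, wd_rel) fm" where
  "wd_C x y z \<equiv> Rel Wd_C [x, y, z]"

definition wd_initial :: "bool list \<Rightarrow> bool list list" where
  "wd_initial t = filter (\<lambda>s. s \<noteq> []) (prefixes t)"

lemma set_wd_initial: "set (wd_initial t) = {s. s \<noteq> [] \<and> prefix s t}"
  by (auto simp: wd_initial_def)

text \<open>
  In the second to last axiom \<open>x, y, z\<close> are the variables \<open>2, 1, 0\<close>; in the last one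
  \<open>x, y, u, v\<close> are \<open>3, 2, 1, 0\<close>.
\<close>

inductive_set WD_R :: "(bool list, wd_rel) fm set" where
  WD1: "s \<noteq> [] \<Longrightarrow> t \<noteq> [] \<Longrightarrow> wd_C (wd_const s) (wd_const t) (wd_const (s @ t)) \<in> WD_R"
| WD2: "s \<noteq> [] \<Longrightarrow> t \<noteq> [] \<Longrightarrow> s \<noteq> t \<Longrightarrow> Neg (wd_const s \<^bold>= wd_const t) \<in> WD_R"
| WD3: "t \<noteq> [] \<Longrightarrow>
    All (wd_le (Var 0) (wd_const t) \<^bold>\<longleftrightarrow>
         Disj (map (\<lambda>s. Var 0 \<^bold>= wd_const s) (wd_initial t))) \<in> WD_R"
| WD4: "All (All (Exi (wd_C (Var 2) (Var 1) (Var 0)))) \<in> WD_R"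
| WD5: "All (All (All (All (wd_C (Var 3) (Var 2) (Var 1) \<^bold>\<and> wd_C (Var 3) (Var 2) (Var 0)
          \<^bold>\<longrightarrow> Var 1 \<^bold>= Var 0)))) \<in> WD_R"


section \<open>The theory \<open>VW\<^sup>+\<close>\<close>

datatype letter = One | Two
datatype vw_fun = Vw_e | Vw_S letter | Vw_f
datatype vw_rel = Vw_init | Vw_len

definition vw_sig :: "(vw_fun, vw_rel) sig" where
  "vw_sig = \<lparr>fun_arity = (\<lambda>f. case f of Vw_e \<Rightarrow> Some 0 | Vw_S d \<Rightarrow> Some 1 | Vw_f \<Rightarrow> Some 1),
             rel_arity = (\<lambda>r. Some 2)\<rparr>"

abbreviation vw_e :: "vw_fun tm" where
  "vw_e \<equiv> Fn Vw_e []"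
abbreviation vw_S :: "letter \<Rightarrow> vw_fun tm \<Rightarrow> vw_fun tm" where
  "vw_S d t \<equiv> Fn (Vw_S d) [t]"
abbreviation vw_f :: "vw_fun tm \<Rightarrow> vw_fun tm" where
  "vw_f t \<equiv> Fn Vw_f [t]"
abbreviation vw_init :: "vw_fun tm \<Rightarrow> vw_fun tm \<Rightarrow> (vw_fun, vw_rel) fm" where
  "vw_init x y \<equiv> Rel Vw_init [x, y]"
abbreviation vw_len :: "vw_fun tm \<Rightarrow> vw_fun tm \<Rightarrow> (vw_fun, vw_rel) fm" where
  "vw_len x y \<equiv> Rel Vw_len [x, y]"

definition canon :: "letter list \<Rightarrow> vw_fun tm" where
  "canon w = foldl (\<lambda>t d. vw_S d t) vw_e w"

lemma canon_simps: "canon [] = vw_e" "canon (w @ [d]) = vw_S d (canon w)"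
  by (simp_all add: canon_def)

definition words_upto :: "nat \<Rightarrow> letter list list" where
  "words_upto m = concat (map (\<lambda>k. List.n_lists k [One, Two]) [0..<Suc m])"

lemma set_words_upto: "set (words_upto m) = {s. length s \<le> m}"
proof -
  have "set s \<subseteq> {One, Two}" for s using letter.exhaust by blast
  then show ?thesis by (auto simp: words_upto_def set_n_lists simp del: upt_Suc)
qed

text \<open>In axioms with two quantified variables, \<open>x\<close> is 1 and \<open>y\<close> is 0.\<close>

inductive_set VW_plus :: "(vw_fun, vw_rel) fm set" where
  VW1: "s \<noteq> t \<Longrightarrow> Neg (canon s \<^bold>= canon t) \<in> VW_plus"
| VW2: "vw_S d (canon t) \<^bold>= canon (t @ [d]) \<in> VW_plus"
| VW3: "vw_init vw_e (canon t) \<in> VW_plus"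
| VW4: "All (vw_init (Var 0) vw_e \<^bold>\<longrightarrow> Var 0 \<^bold>= vw_e) \<in> VW_plus"
| VW5: "All (vw_init (Var 0) (vw_S d (canon t)) \<^bold>\<longleftrightarrow>
          vw_init (Var 0) (canon t) \<^bold>\<or> Var 0 \<^bold>= vw_S d (canon t)) \<in> VW_plus"
| VW6: "All (vw_len (Var 0) (canon (replicate m Two)) \<^bold>\<longleftrightarrow>
          Disj (map (\<lambda>s. Var 0 \<^bold>= canon s) (words_upto m))) \<in> VW_plus"
| VW7: "(Exi (vw_len (Var 0) (canon t)) \<^bold>\<longrightarrow>
          All (vw_init (Var 0) (canon t) \<^bold>\<and> Neg (Var 0 \<^bold>= vw_e) \<^bold>\<longrightarrow>
               vw_init (canon [Two]) (vw_f (Var 0)))) \<in> VW_plus"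
| VW8: "vw_f (canon t) \<^bold>= canon (rev t) \<in> VW_plus"
| VW9: "All (All (vw_f (Var 1) \<^bold>= vw_f (Var 0) \<^bold>\<longrightarrow> Var 1 \<^bold>= Var 0)) \<in> VW_plus"
| VW10: "All (All (vw_init (Var 1) (Var 0) \<^bold>\<and> vw_init (Var 0) (Var 1)
           \<^bold>\<longrightarrow> Var 1 \<^bold>= Var 0)) \<in> VW_plus"

end

theory Submission
  imports Defs "HOL-Library.Countable"
begin

text \<open>
  By completeness it suffices to define, uniformly in all models of \<open>VW\<^sup>+\<close>, a model of \<open>WD\<^sub>R\<close>.
  The domain is everything, the bits 0 and 1 become the letters 1 and 2, and \<open>x \<preceq> y\<close> becomes
  \<open>x \<sqsubseteq> y \<and> x \<noteq> e\<close>. For standard nonempty \<open>s\<close>, \<open>t\<close>, the word \<open>s\<frown>t\<close> is the one with initial segment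
  \<open>s\<close>, final segment \<open>t\<close> and length \<open>m = |s| + |t|\<close>. Addition of lengths is expressible: \<open>m\<close> is the
  least \<open>n\<close> such that some word of length at most \<open>n\<close> starts with \<open>2\<^sup>i1\<close>, where \<open>i \<ge> |s|\<close>, and ends with
  \<open>2\<^sup>j\<close>, where \<open>j + 1 \<ge> |t|\<close>.

  Lengths are represented by tallies: elements whose initial segments are closed under appending 2.
  A tally is either a standard \<open>2\<^sup>k\<close> or has every standard \<open>2\<^sup>k\<close> as an initial segment. Hence choosing
  the least tally that works rules out nonstandard witnesses, and \<open>C(s, t, z)\<close> holds only for
  \<open>z = s\<frown>t\<close>. Where the resulting relation does not determine a unique \<open>z\<close>, which is possible only for
  nonstandard or empty arguments, \<open>C(x, y, z)\<close> is defined as \<open>z = x\<close>.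
\<close>

section \<open>Substitution\<close>

lemma subst_tm_cong: "(\<And>i. i \<in> fv_tm t \<Longrightarrow> \<sigma> i = \<tau> i) \<Longrightarrow> subst_tm \<sigma> t = subst_tm \<tau> t"
  by (induction t) auto

lemma wf_tm_subst: "wf_tm \<Sigma> t \<Longrightarrow> (\<And>i. wf_tm \<Sigma> (\<sigma> i)) \<Longrightarrow> wf_tm \<Sigma> (subst_tm \<sigma> t)"
  by (induction t) (auto simp: list_all_iff)

lemma subst_tm_Var [simp]: "subst_tm Var t = t"
  by (induction t) (auto simp: map_idI)

lemma subst_tm_subst_tm: "subst_tm \<sigma> (subst_tm \<tau> t) = subst_tm (\<lambda>i. subst_tm \<sigma> (\<tau> i)) t"
  by (induction t) auto

lemma lift_subst_simps [simp]:
  "lift_subst \<sigma> 0 = Var 0"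
  "lift_subst \<sigma> (Suc i) = subst_tm (\<lambda>j. Var (Suc j)) (\<sigma> i)"
  by (simp_all add: lift_subst_def)

lemma wf_lift_subst: "(\<And>i. wf_tm \<Sigma> (\<sigma> i)) \<Longrightarrow> wf_tm \<Sigma> (lift_subst \<sigma> i)"
  by (cases i) (auto intro: wf_tm_subst)

lemma lift_subst_Var [simp]: "lift_subst Var = Var"
proof
  show "lift_subst Var i = Var i" for i by (cases i) auto
qed

lemma lift_subst_comp:
  "(\<lambda>i. subst_tm (lift_subst \<sigma>) (lift_subst \<tau> i)) = lift_subst (\<lambda>i. subst_tm \<sigma> (\<tau> i))"
proof
  show "subst_tm (lift_subst \<sigma>) (lift_subst \<tau> i) = lift_subst (\<lambda>i. subst_tm \<sigma> (\<tau> i)) i" for i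
    by (cases i) (auto simp: subst_tm_subst_tm)
qed

lemma subst_fm_cong: "(\<And>i. i \<in> fv_fm \<phi> \<Longrightarrow> \<sigma> i = \<tau> i) \<Longrightarrow> subst_fm \<sigma> \<phi> = subst_fm \<tau> \<phi>"
proof (induction \<phi> arbitrary: \<sigma> \<tau>)
  case (Eq s t)
  then show ?case by (auto intro: subst_tm_cong)
next
  case (Rel r ts)
  then show ?case by (auto intro!: subst_tm_cong)
next
  case (Imp \<phi> \<psi>)
  from Imp.IH(1)[of \<sigma> \<tau>] Imp.IH(2)[of \<sigma> \<tau>] Imp.prems show ?case by simp
next
  case (All \<phi>)
  have "lift_subst \<sigma> i = lift_subst \<tau> i" if "i \<in> fv_fm \<phi>" for i
    using that All.prems by (cases i) auto
  from All.IH[OF this] show ?case by simp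
qed auto

lemma subst_fm_Var [simp]: "subst_fm Var \<phi> = \<phi>"
  by (induction \<phi>) (auto simp: map_idI)

lemma subst_fm_subst_fm: "subst_fm \<sigma> (subst_fm \<tau> \<phi>) = subst_fm (\<lambda>i. subst_tm \<sigma> (\<tau> i)) \<phi>"
  by (induction \<phi> arbitrary: \<sigma> \<tau>) (auto simp: subst_tm_subst_tm lift_subst_comp)

lemma wf_fm_subst: "wf_fm \<Sigma> \<phi> \<Longrightarrow> (\<And>i. wf_tm \<Sigma> (\<sigma> i)) \<Longrightarrow> wf_fm \<Sigma> (subst_fm \<sigma> \<phi>)"
proof (induction \<phi> arbitrary: \<sigma>)
  case (All \<phi>)
  then show ?case by (simp add: wf_lift_subst)
qed (auto simp: list_all_iff wf_tm_subst)

lemma wf_fm_inst: "wf_fm \<Sigma> \<phi> \<Longrightarrow> wf_tm \<Sigma> t \<Longrightarrow> wf_fm \<Sigma> (inst \<phi> t)"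
  unfolding inst_def by (rule wf_fm_subst) (auto split: nat.split)

text \<open>A lifted substitution reserves variable 0 for the binder and shifts all other images out
  of its way. Instantiation undoes the shift, so the two operations merge into a single
  substitution.\<close>

lemma inst_lift: "inst (subst_fm (lift_subst \<sigma>) \<phi>) t = subst_fm (case_nat t \<sigma>) \<phi>"
  unfolding inst_def subst_fm_subst_fm
  by (rule subst_fm_cong) (auto simp: subst_tm_subst_tm split: nat.split)

lemma subst_inst: "subst_fm \<sigma> (inst \<phi> t) = inst (subst_fm (lift_subst \<sigma>) \<phi>) (subst_tm \<sigma> t)"
  unfolding inst_lift unfolding inst_def subst_fm_subst_fm
  by (rule subst_fm_cong) (auto split: nat.split)

text \<open>Serves the uses of Leibniz's law: in a formula with \<open>Var 0\<close> as a hole, the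
  surrounding terms are shifted, so that filling the hole restores them.\<close>

lemma inst_shift: "subst_tm (case_nat s Var) (subst_tm (\<lambda>i. Var (Suc i)) t) = t"
  by (simp add: subst_tm_subst_tm)

lemma finite_fv_tm: "finite (fv_tm t)"
  by (induction t) auto

lemma finite_fv_fm: "finite (fv_fm \<phi>)"
proof (induction \<phi>)
  case (All \<phi>)
  have "fv_fm (All \<phi>) = Suc -` fv_fm \<phi>" by auto
  then show ?case using All by (simp add: finite_vimageI)
qed (auto simp: finite_fv_tm)


section \<open>Derivations\<close>

lemma deriv_mono: "deriv \<Sigma> \<Gamma> \<phi> \<Longrightarrow> \<Gamma> \<subseteq> \<Delta> \<Longrightarrow> deriv \<Sigma> \<Delta> \<phi>"
proof (induction arbitrary: \<Delta> rule: deriv.induct)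
  case (ImpI \<phi> \<Gamma> \<psi>)
  then show ?case by (meson deriv.ImpI insert_mono)
next
  case (Raa \<phi> \<Gamma>)
  then show ?case by (meson deriv.Raa insert_mono)
next
  case (AllI \<Gamma> \<phi>)
  then show ?case by (intro deriv.AllI) (simp add: image_mono)
next
  case (ImpE \<Gamma> \<phi> \<psi>)
  then show ?case by (meson deriv.ImpE)
next
  case (EqSubst \<phi> \<Gamma> s t)
  then show ?case by (meson deriv.EqSubst)
qed (auto intro: Asm AllE EqRefl)

lemma deriv_subst:
  "deriv \<Sigma> \<Gamma> \<phi> \<Longrightarrow> (\<And>i. wf_tm \<Sigma> (\<sigma> i)) \<Longrightarrow> deriv \<Sigma> (subst_fm \<sigma> ` \<Gamma>) (subst_fm \<sigma> \<phi>)"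
proof (induction arbitrary: \<sigma> rule: deriv.induct)
  case (AllI \<Gamma> \<phi>)
  \<comment> \<open>\<open>AllI\<close> shifts the assumptions, and a lifted substitution after the
    shift agrees with the shift after the original substitution.\<close>
  have "subst_fm (lift_subst \<sigma>) ` rename_fm Suc ` \<Gamma> = rename_fm Suc ` subst_fm \<sigma> ` \<Gamma>"
    by (auto simp: image_image subst_fm_subst_fm)
  with AllI.IH[of "lift_subst \<sigma>"] AllI.prems show ?case
    by (auto intro: deriv.AllI wf_lift_subst)
next
  case (AllE \<Gamma> \<phi> t)
  then show ?case unfolding subst_inst
    by (auto intro!: deriv.AllE[of _ _ "subst_fm (lift_subst \<sigma>) \<phi>"] wf_tm_subst)
next
  case (EqSubst \<phi> \<Gamma> s t)
  have "deriv \<Sigma> (subst_fm \<sigma> ` \<Gamma>) (subst_tm \<sigma> s \<^bold>= subst_tm \<sigma> t)"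
    using EqSubst.IH(1) EqSubst.prems by simp
  moreover have "deriv \<Sigma> (subst_fm \<sigma> ` \<Gamma>) (inst (subst_fm (lift_subst \<sigma>) \<phi>) (subst_tm \<sigma> s))"
    using EqSubst.IH(2) EqSubst.prems unfolding subst_inst by simp
  moreover have "wf_fm \<Sigma> (subst_fm (lift_subst \<sigma>) \<phi>)"
    using EqSubst.hyps(1) EqSubst.prems by (simp add: wf_fm_subst wf_lift_subst)
  ultimately show ?case unfolding subst_inst by (rule deriv.EqSubst[rotated])
next
  case (ImpI \<phi> \<Gamma> \<psi>)
  then show ?case by (auto intro!: deriv.ImpI wf_fm_subst)
next
  case (Raa \<phi> \<Gamma>)
  then show ?case by (intro deriv.Raa[of \<Sigma> "subst_fm \<sigma> \<phi>"]) (auto simp: wf_fm_subst)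
next
  case (ImpE \<Gamma> \<phi> \<psi>)
  then show ?case by (metis deriv.ImpE subst_fm.simps(4))
qed (auto intro: Asm EqRefl wf_tm_subst)

lemma deriv_compact: "deriv \<Sigma> \<Gamma> \<phi> \<Longrightarrow> \<exists>\<Delta>\<subseteq>\<Gamma>. finite \<Delta> \<and> deriv \<Sigma> \<Delta> \<phi>"
proof (induction rule: deriv.induct)
  case (Asm \<phi> \<Gamma>)
  then show ?case by (intro exI[of _ "{\<phi>}"]) (auto intro: deriv.Asm)
next
  case (ImpI \<phi> \<Gamma> \<psi>)
  then obtain \<Delta> where "\<Delta> \<subseteq> insert \<phi> \<Gamma>" "finite \<Delta>" "deriv \<Sigma> \<Delta> \<psi>" by blast
  \<comment> \<open>The discharged assumption may lie outside \<open>\<Gamma>\<close>, so it is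
    taken out of the finite set; the rule inserts it again.\<close>
  with ImpI.hyps show ?case
    by (intro exI[of _ "\<Delta> - {\<phi>}"] conjI deriv.ImpI) (auto elim: deriv_mono)
next
  case (Raa \<phi> \<Gamma>)
  then obtain \<Delta> where "\<Delta> \<subseteq> insert (Neg \<phi>) \<Gamma>" "finite \<Delta>" "deriv \<Sigma> \<Delta> Bot" by blast
  with Raa.hyps show ?case
    by (intro exI[of _ "\<Delta> - {Neg \<phi>}"] conjI deriv.Raa[of \<Sigma> \<phi>]) (auto elim: deriv_mono)
next
  case (ImpE \<Gamma> \<phi> \<psi>)
  then obtain \<Delta> \<Delta>' where \<Delta>: "\<Delta> \<subseteq> \<Gamma>" "finite \<Delta>" "deriv \<Sigma> \<Delta> (\<phi> \<^bold>\<longrightarrow> \<psi>)"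
    "\<Delta>' \<subseteq> \<Gamma>" "finite \<Delta>'" "deriv \<Sigma> \<Delta>' \<phi>" by blast
  then have "deriv \<Sigma> (\<Delta> \<union> \<Delta>') \<psi>" by (meson deriv.ImpE deriv_mono Un_upper1 Un_upper2)
  with \<Delta> show ?case by (intro exI[of _ "\<Delta> \<union> \<Delta>'"]) auto
next
  case (AllI \<Gamma> \<phi>)
  then obtain \<Delta> where \<Delta>: "\<Delta> \<subseteq> rename_fm Suc ` \<Gamma>" "finite \<Delta>" "deriv \<Sigma> \<Delta> \<phi>" by blast
  then obtain \<Delta>' where "\<Delta>' \<subseteq> \<Gamma>" "finite \<Delta>'" "\<Delta> = rename_fm Suc ` \<Delta>'"
    using finite_subset_image by metis
  with \<Delta> show ?case by (auto intro: deriv.AllI)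
next
  case (AllE \<Gamma> \<phi> t)
  then show ?case by (meson deriv.AllE)
next
  case (EqRefl t \<Gamma>)
  then show ?case by (intro exI[of _ "{}"]) (auto intro: deriv.EqRefl)
next
  case (EqSubst \<phi> \<Gamma> s t)
  then obtain \<Delta> \<Delta>' where \<Delta>: "\<Delta> \<subseteq> \<Gamma>" "finite \<Delta>" "deriv \<Sigma> \<Delta> (s \<^bold>= t)"
    "\<Delta>' \<subseteq> \<Gamma>" "finite \<Delta>'" "deriv \<Sigma> \<Delta>' (inst \<phi> s)" by blast
  then have "deriv \<Sigma> (\<Delta> \<union> \<Delta>') (inst \<phi> t)"
    by (meson EqSubst.hyps(1) deriv.EqSubst deriv_mono Un_upper1 Un_upper2)
  with \<Delta> show ?case by (intro exI[of _ "\<Delta> \<union> \<Delta>'"]) auto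
qed

lemma deriv_Bot: "deriv \<Sigma> \<Gamma> Bot \<Longrightarrow> wf_fm \<Sigma> \<phi> \<Longrightarrow> deriv \<Sigma> \<Gamma> \<phi>"
  by (rule Raa) (auto elim: deriv_mono)

lemma deriv_cut: "deriv \<Sigma> \<Gamma> \<phi> \<Longrightarrow> wf_fm \<Sigma> \<phi> \<Longrightarrow> deriv \<Sigma> (insert \<phi> \<Gamma>) \<psi> \<Longrightarrow> deriv \<Sigma> \<Gamma> \<psi>"
  by (meson ImpI ImpE)

text \<open>Translates named freshness into the shift of \<open>AllI\<close>. The substitution that
  sends \<open>k\<close> to 0 and raises every other index acts as the plain shift on assumptions
  without \<open>k\<close>, and it turns the instance at \<open>k\<close> back into
  \<open>\<phi>\<close>.\<close>

lemma deriv_gen: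
  assumes "deriv \<Sigma> \<Gamma> (inst \<phi> (Var k))" "k \<notin> \<Union> (fv_fm ` \<Gamma>)" "Suc k \<notin> fv_fm \<phi>"
  shows "deriv \<Sigma> \<Gamma> (All \<phi>)"
proof -
  let ?\<sigma> = "\<lambda>i. Var (if i = k then 0 else Suc i)"
  have "subst_fm ?\<sigma> \<gamma> = rename_fm Suc \<gamma>" if "\<gamma> \<in> \<Gamma>" for \<gamma>
    using that assms(2) by (intro subst_fm_cong) auto
  then have "subst_fm ?\<sigma> ` \<Gamma> = rename_fm Suc ` \<Gamma>" by (intro image_cong) auto
  moreover have "subst_fm ?\<sigma> (inst \<phi> (Var k)) = subst_fm Var \<phi>"
    unfolding inst_def subst_fm_subst_fm
    using assms(3) by (intro subst_fm_cong) (auto split: nat.split)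
  ultimately show ?thesis using deriv_subst[OF assms(1), of ?\<sigma>] by (auto intro: AllI)
qed


section \<open>Semantics and completeness\<close>

primrec eval :: "('f \<Rightarrow> 'u list \<Rightarrow> 'u) \<Rightarrow> (nat \<Rightarrow> 'u) \<Rightarrow> 'f tm \<Rightarrow> 'u" where
  "eval F e (Var i) = e i"
| "eval F e (Fn f ts) = F f (map (eval F e) ts)"

text \<open>Quantifiers range over an explicit carrier because the classes of terms forming the term
  model are only some of the elements of their type.\<close>

primrec sat ::
  "'u set \<Rightarrow> ('f \<Rightarrow> 'u list \<Rightarrow> 'u) \<Rightarrow> ('r \<Rightarrow> 'u list \<Rightarrow> bool) \<Rightarrow> (nat \<Rightarrow> 'u) \<Rightarrow> ('f, 'r) fm \<Rightarrow> bool"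
where
  "sat U F R e Bot \<longleftrightarrow> False"
| "sat U F R e (s \<^bold>= t) \<longleftrightarrow> eval F e s = eval F e t"
| "sat U F R e (Rel r ts) \<longleftrightarrow> R r (map (eval F e) ts)"
| "sat U F R e (\<phi> \<^bold>\<longrightarrow> \<psi>) \<longleftrightarrow> (sat U F R e \<phi> \<longrightarrow> sat U F R e \<psi>)"
| "sat U F R e (All \<phi>) \<longleftrightarrow> (\<forall>x\<in>U. sat U F R (case_nat x e) \<phi>)"

definition is_structure :: "('f, 'r) sig \<Rightarrow> 'u set \<Rightarrow> ('f \<Rightarrow> 'u list \<Rightarrow> 'u) \<Rightarrow> bool" where
  "is_structure \<Sigma> U F \<longleftrightarrow> U \<noteq> {} \<and>
     (\<forall>f xs. fun_arity \<Sigma> f = Some (length xs) \<longrightarrow> set xs \<subseteq> U \<longrightarrow> F f xs \<in> U)"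

lemma eval_subst: "eval F e (subst_tm \<sigma> t) = eval F (\<lambda>i. eval F e (\<sigma> i)) t"
  by (induction t) (auto intro!: arg_cong[of _ _ "F _"])

lemma eval_lift_subst:
  "(\<lambda>i. eval F (case_nat x e) (lift_subst \<sigma> i)) = case_nat x (\<lambda>i. eval F e (\<sigma> i))"
  by (rule ext) (simp add: lift_subst_def eval_subst split: nat.split)

lemma sat_subst: "sat U F R e (subst_fm \<sigma> \<phi>) \<longleftrightarrow> sat U F R (\<lambda>i. eval F e (\<sigma> i)) \<phi>"
proof (induction \<phi> arbitrary: e \<sigma>)
  case (Rel r ts)
  then show ?case by (auto simp: eval_subst comp_def)
qed (auto simp: eval_subst eval_lift_subst)

lemma sat_Disj: "sat U F R e (Disj \<phi>s) \<longleftrightarrow> (\<exists>\<phi>\<in>set \<phi>s. sat U F R e \<phi>)"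
  by (induction \<phi>s) (auto simp: Disj_def)

lemma sat_Conj: "sat U F R e (Conj \<phi>s) \<longleftrightarrow> (\<forall>\<phi>\<in>set \<phi>s. sat U F R e \<phi>)"
  by (induction \<phi>s) (auto simp: Conj_def)

section \<open>Maximal consistent sets with variables as witnesses\<close>

locale saturated =
  fixes \<Sigma> :: "('f, 'r) sig" and H :: "('f, 'r) fm set"
  assumes wf: "\<phi> \<in> H \<Longrightarrow> wf_fm \<Sigma> \<phi>"
    and consistent: "\<not> deriv \<Sigma> H Bot"
    and maximal: "wf_fm \<Sigma> \<phi> \<Longrightarrow> \<phi> \<notin> H \<Longrightarrow> deriv \<Sigma> (insert \<phi> H) Bot"
    and witnessed: "Neg (All \<phi>) \<in> H \<Longrightarrow> \<exists>k. Neg (inst \<phi> (Var k)) \<in> H"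
begin

lemma deriv_mem: "deriv \<Sigma> H \<phi> \<Longrightarrow> wf_fm \<Sigma> \<phi> \<Longrightarrow> \<phi> \<in> H"
  using maximal consistent deriv_cut by blast

lemma Bot_notin: "Bot \<notin> H"
  using consistent Asm by blast

lemma Imp_mem:
  assumes "wf_fm \<Sigma> \<phi>" "wf_fm \<Sigma> \<psi>"
  shows "(\<phi> \<^bold>\<longrightarrow> \<psi>) \<in> H \<longleftrightarrow> (\<phi> \<in> H \<longrightarrow> \<psi> \<in> H)"
proof
  assume "(\<phi> \<^bold>\<longrightarrow> \<psi>) \<in> H"
  then show "\<phi> \<in> H \<longrightarrow> \<psi> \<in> H" using assms deriv_mem by (meson Asm ImpE)
next
  assume R: "\<phi> \<in> H \<longrightarrow> \<psi> \<in> H"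
  have "deriv \<Sigma> (insert \<phi> H) \<psi>"
  proof (cases "\<phi> \<in> H")
    case True
    with R show ?thesis by (simp add: Asm)
  next
    case False
    with assms show ?thesis by (meson maximal deriv_Bot)
  qed
  with assms show "(\<phi> \<^bold>\<longrightarrow> \<psi>) \<in> H" by (intro deriv_mem ImpI) auto
qed

lemma All_mem:
  assumes "wf_fm \<Sigma> \<phi>"
  shows "All \<phi> \<in> H \<longleftrightarrow> (\<forall>t. wf_tm \<Sigma> t \<longrightarrow> inst \<phi> t \<in> H)"
proof
  assume "All \<phi> \<in> H"
  then show "\<forall>t. wf_tm \<Sigma> t \<longrightarrow> inst \<phi> t \<in> H"
    using assms by (meson Asm AllE deriv_mem wf_fm_inst)
next
  assume R: "\<forall>t. wf_tm \<Sigma> t \<longrightarrow> inst \<phi> t \<in> H"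
  show "All \<phi> \<in> H"
  proof (rule ccontr)
    assume "All \<phi> \<notin> H"
    with assms have "Neg (All \<phi>) \<in> H" using Imp_mem[of "All \<phi>" Bot] by simp
    then obtain k where "Neg (inst \<phi> (Var k)) \<in> H" using witnessed by blast
    moreover have "inst \<phi> (Var k) \<in> H" using R by simp
    ultimately show False using Bot_notin Imp_mem[of "inst \<phi> (Var k)" Bot] assms
      by (simp add: wf_fm_inst)
  qed
qed

abbreviation eqv :: "'f tm \<Rightarrow> 'f tm \<Rightarrow> bool" where
  "eqv s t \<equiv> (s \<^bold>= t) \<in> H"

lemma eqv_wf: "eqv s t \<Longrightarrow> wf_tm \<Sigma> s \<and> wf_tm \<Sigma> t"
  using wf by fastforce

lemma eqv_refl: "wf_tm \<Sigma> t \<Longrightarrow> eqv t t"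
  by (intro deriv_mem EqRefl) auto

lemma eqv_subst:
  assumes "eqv s t" "wf_fm \<Sigma> \<phi>" "inst \<phi> s \<in> H"
  shows "inst \<phi> t \<in> H"
proof (rule deriv_mem)
  show "deriv \<Sigma> H (inst \<phi> t)"
    using assms by (meson Asm EqSubst)
  show "wf_fm \<Sigma> (inst \<phi> t)" using assms eqv_wf wf_fm_inst by blast
qed

abbreviation "shift_tm \<equiv> subst_tm (\<lambda>i. Var (Suc i))"

lemma eqv_sym: assumes "eqv s t" shows "eqv t s"
  using eqv_subst[of s t "Var 0 \<^bold>= shift_tm s"] assms eqv_wf[OF assms] eqv_refl
  by (simp add: inst_def inst_shift wf_tm_subst)

lemma eqv_trans: assumes "eqv s t" "eqv t u" shows "eqv s u"
  using eqv_subst[of t u "shift_tm s \<^bold>= Var 0"] assms eqv_wf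
  by (simp add: inst_def inst_shift wf_tm_subst)

text \<open>Arguments are exchanged one at a time from the left; \<open>as\<close> collects those
  already replaced. This reduces congruence in a list to Leibniz's law for a single hole.\<close>

lemma eqv_list_step:
  assumes "list_all2 eqv ss ts"
    and "\<And>as s t bs. eqv s t \<Longrightarrow> P (as @ s # bs) \<Longrightarrow> P (as @ t # bs)"
    and "P (as @ ss)"
  shows "P (as @ ts)"
  using assms(1,3)
proof (induction arbitrary: as rule: list_all2_induct)
  case (Cons s ss t ts)
  from Cons.hyps Cons.prems assms(2) have "P ((as @ [t]) @ ss)" by simp
  then have "P ((as @ [t]) @ ts)" by (rule Cons.IH)
  then show ?case by simp
qed simp

lemma eqv_Rel:
  assumes "list_all2 eqv ss ts" "Rel r ss \<in> H"
  shows "Rel r ts \<in> H"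
proof -
  have "Rel r (as @ t # bs) \<in> H" if "eqv s t" "Rel r (as @ s # bs) \<in> H" for as s t bs
  proof -
    have "wf_fm \<Sigma> (Rel r (as @ s # bs))" using that(2) wf by blast
    then show ?thesis
      using eqv_subst[of s t "Rel r (map shift_tm as @ Var 0 # map shift_tm bs)"] that
      by (simp add: inst_def inst_shift comp_def list_all_iff wf_tm_subst ball_Un)
  qed
  then show ?thesis using eqv_list_step[of ss ts "\<lambda>l. Rel r l \<in> H" "[]"] assms by simp
qed

lemma eqv_Fn:
  assumes "list_all2 eqv ss ts" "wf_tm \<Sigma> (Fn f ss)"
  shows "eqv (Fn f ss) (Fn f ts)"
proof -
  let ?g = "shift_tm (Fn f ss)"
  have "eqv (Fn f ss) (Fn f (as @ t # bs))"
    if "eqv s t" "eqv (Fn f ss) (Fn f (as @ s # bs))" for as s t bs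
  proof -
    have "wf_tm \<Sigma> (Fn f (as @ s # bs))" using that(2) eqv_wf by blast
    then show ?thesis
      using eqv_subst[of s t "?g \<^bold>= Fn f (map shift_tm as @ Var 0 # map shift_tm bs)"] that assms(2)
      by (simp add: inst_def inst_shift comp_def list_all_iff wf_tm_subst ball_Un)
  qed
  then show ?thesis
    using eqv_list_step[of ss ts "\<lambda>l. eqv (Fn f ss) (Fn f l)" "[]"] assms eqv_refl by simp
qed

section \<open>The term model as a quotient by the equations in \<open>H\<close>\<close>

definition "cls t = {u. eqv t u}"
definition "rep X = (SOME t. t \<in> X)"
definition "term_univ = cls ` {t. wf_tm \<Sigma> t}"
text \<open>Functions and relations are computed on chosen representatives; \<open>eqv_Fn\<close>
  and \<open>eqv_Rel\<close> make the choice immaterial.\<close>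

definition "term_fun f Xs = cls (Fn f (map rep Xs))"
definition "term_rel r Xs \<longleftrightarrow> Rel r (map rep Xs) \<in> H"

lemma cls_eq: "wf_tm \<Sigma> s \<Longrightarrow> cls s = cls t \<longleftrightarrow> eqv s t"
  unfolding cls_def using eqv_refl eqv_sym eqv_trans by blast

lemma eqv_rep: "wf_tm \<Sigma> t \<Longrightarrow> eqv t (rep (cls t))"
  unfolding rep_def cls_def by (metis (mono_tags) eqv_refl mem_Collect_eq someI)

lemma rep_wf: "X \<in> term_univ \<Longrightarrow> wf_tm \<Sigma> (rep X)"
  using eqv_rep eqv_wf by (auto simp: term_univ_def)

lemma list_eqv_rep: "list_all (wf_tm \<Sigma>) ts \<Longrightarrow> list_all2 eqv ts (map rep (map cls ts))"
  by (auto simp: list_all2_conv_all_nth list_all_length eqv_rep)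

lemma is_structure_term: "is_structure \<Sigma> term_univ term_fun"
  unfolding is_structure_def
proof (intro conjI allI impI)
  have "wf_tm \<Sigma> (Var 0)" by simp
  then show "term_univ \<noteq> {}" unfolding term_univ_def by blast
  fix f and xs :: "'f tm set list"
  assume "fun_arity \<Sigma> f = Some (length xs)" "set xs \<subseteq> term_univ"
  then have "wf_tm \<Sigma> (Fn f (map rep xs))" using rep_wf by (auto simp: list_all_iff)
  then show "term_fun f xs \<in> term_univ" unfolding term_fun_def term_univ_def by blast
qed

lemma eval_term:
  assumes "wf_tm \<Sigma> t" "\<And>i. wf_tm \<Sigma> (\<sigma> i)"
  shows "eval term_fun (\<lambda>i. cls (\<sigma> i)) t = cls (subst_tm \<sigma> t)"
  using assms(1)
proof (induction t)
  case (Fn f ts)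
  let ?ts = "map (subst_tm \<sigma>) ts"
  have wf: "wf_tm \<Sigma> (Fn f ?ts)" using Fn.prems assms(2) wf_tm_subst[of \<Sigma> "Fn f ts" \<sigma>] by simp
  then have "list_all2 eqv ?ts (map rep (map cls ?ts))" by (intro list_eqv_rep) simp
  then have "eqv (Fn f ?ts) (Fn f (map rep (map cls ?ts)))" using wf by (rule eqv_Fn)
  then have "cls (Fn f (map rep (map cls ?ts))) = cls (Fn f ?ts)" using wf cls_eq by metis
  moreover have "map (eval term_fun (\<lambda>i. cls (\<sigma> i))) ts = map cls ?ts"
    using Fn by (auto simp: list_all_iff)
  ultimately show ?case by (simp only: eval.simps subst_tm.simps term_fun_def[of f "map cls ?ts"])
qed simp

text \<open>The truth lemma. It is proved for all substitutions at once because in the quantifier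
  case the class of a term \<open>t\<close> becomes the value of the bound variable, which extends
  \<open>\<sigma>\<close> by \<open>t\<close>.\<close>

lemma sat_term:
  assumes "wf_fm \<Sigma> \<phi>" "\<And>i. wf_tm \<Sigma> (\<sigma> i)"
  shows "sat term_univ term_fun term_rel (\<lambda>i. cls (\<sigma> i)) \<phi> \<longleftrightarrow> subst_fm \<sigma> \<phi> \<in> H"
  using assms
proof (induction \<phi> arbitrary: \<sigma>)
  case Bot
  then show ?case using Bot_notin by simp
next
  case (Eq s t)
  then show ?case by (simp add: eval_term cls_eq wf_tm_subst)
next
  case (Rel r ts)
  let ?ts = "map (subst_tm \<sigma>) ts"
  have "list_all (wf_tm \<Sigma>) ?ts" using Rel by (auto simp: list_all_iff wf_tm_subst)
  then have *: "list_all2 eqv ?ts (map rep (map cls ?ts))" by (rule list_eqv_rep)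
  then have "list_all2 eqv (map rep (map cls ?ts)) ?ts"
    using eqv_sym by (simp add: list_all2_conv_all_nth)
  with * have "Rel r ?ts \<in> H \<longleftrightarrow> Rel r (map rep (map cls ?ts)) \<in> H" using eqv_Rel by blast
  moreover have "map (eval term_fun (\<lambda>i. cls (\<sigma> i))) ts = map cls ?ts"
    using Rel by (auto simp: list_all_iff eval_term)
  ultimately show ?case by (simp only: sat.simps subst_fm.simps term_rel_def)
next
  case (Imp \<phi> \<psi>)
  then show ?case using Imp_mem[of "subst_fm \<sigma> \<phi>" "subst_fm \<sigma> \<psi>"] by (simp add: wf_fm_subst)
next
  case (All \<phi>)
  have "sat term_univ term_fun term_rel (case_nat (cls t) (\<lambda>i. cls (\<sigma> i))) \<phi> \<longleftrightarrow>
      inst (subst_fm (lift_subst \<sigma>) \<phi>) t \<in> H" if "wf_tm \<Sigma> t" for t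
  proof -
    have "case_nat (cls t) (\<lambda>i. cls (\<sigma> i)) = (\<lambda>i. cls (case_nat t \<sigma> i))"
      by (rule ext) (simp split: nat.split)
    then show ?thesis
      using All.IH[of "case_nat t \<sigma>"] All.prems that by (simp add: inst_lift split: nat.split)
  qed
  moreover have "wf_fm \<Sigma> (subst_fm (lift_subst \<sigma>) \<phi>)"
    using All.prems by (simp add: wf_fm_subst wf_lift_subst)
  ultimately show ?case by (simp add: All_mem term_univ_def)
qed

lemma sat_term_Var: "wf_fm \<Sigma> \<phi> \<Longrightarrow> sat term_univ term_fun term_rel (\<lambda>i. cls (Var i)) \<phi> \<longleftrightarrow> \<phi> \<in> H"
  using sat_term[of \<phi> Var] by simp

end

section \<open>Construction of a saturated extension\<close>

lemma deriv_witness: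
  assumes "\<not> deriv \<Sigma> \<Gamma> Bot" "Neg (All \<phi>) \<in> \<Gamma>" "wf_fm \<Sigma> \<phi>"
    "k \<notin> \<Union> (fv_fm ` \<Gamma>)" "Suc k \<notin> fv_fm \<phi>"
  shows "\<not> deriv \<Sigma> (insert (Neg (inst \<phi> (Var k))) \<Gamma>) Bot"
proof
  assume "deriv \<Sigma> (insert (Neg (inst \<phi> (Var k))) \<Gamma>) Bot"
  \<comment> \<open>A refuted counterexample proves the instance at \<open>k\<close>; since
    \<open>k\<close> is fresh, this generalizes and contradicts the negated universal
    assumption.\<close>
  with assms(3) have "deriv \<Sigma> \<Gamma> (inst \<phi> (Var k))" by (simp add: Raa wf_fm_inst)
  then have "deriv \<Sigma> \<Gamma> (All \<phi>)" using assms(4,5) by (rule deriv_gen)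
  with assms(1,2) show False by (meson Asm ImpE)
qed

text \<open>
  Henkin witnesses are variables. No constants need to be added, since a set of sentences enlarged by
  finitely many formulas leaves infinitely many variables unused.
\<close>

definition fresh :: "('f, 'r) fm set \<Rightarrow> ('f, 'r) fm \<Rightarrow> nat" where
  "fresh \<Gamma> \<phi> = (SOME k. k \<notin> \<Union> (fv_fm ` \<Gamma>) \<and> Suc k \<notin> fv_fm \<phi>)"

lemma fresh:
  assumes "finite (\<Union> (fv_fm ` \<Gamma>))"
  shows "fresh \<Gamma> \<phi> \<notin> \<Union> (fv_fm ` \<Gamma>) \<and> Suc (fresh \<Gamma> \<phi>) \<notin> fv_fm \<phi>"
proof -
  have "finite (\<Union> (fv_fm ` \<Gamma>) \<union> Suc -` fv_fm \<phi>)"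
    using assms by (simp add: finite_fv_fm finite_vimageI)
  then obtain k where "k \<notin> \<Union> (fv_fm ` \<Gamma>) \<union> Suc -` fv_fm \<phi>"
    using ex_new_if_finite infinite_UNIV_nat by blast
  then have "k \<notin> \<Union> (fv_fm ` \<Gamma>) \<and> Suc k \<notin> fv_fm \<phi>" by simp
  then show ?thesis unfolding fresh_def by (rule someI)
qed

text \<open>The comprehension acts as an optional element: it is empty unless \<open>\<psi>\<close>
  is a negated universal formula, and a singleton otherwise. Freshness is measured against the set
  that already contains \<open>\<psi>\<close>.\<close>

definition add_witness :: "('f, 'r) fm \<Rightarrow> ('f, 'r) fm set \<Rightarrow> ('f, 'r) fm set" where
  "add_witness \<psi> \<Gamma> =
     insert \<psi> \<Gamma> \<union> {Neg (inst \<phi> (Var (fresh (insert \<psi> \<Gamma>) \<phi>))) |\<phi>. \<psi> = Neg (All \<phi>)}"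

instance tm :: (countable) countable by countable_datatype
instance fm :: (countable, countable) countable by countable_datatype

text \<open>Countability lets a single sequence run through all formulas: the turn of
  \<open>\<phi>\<close> comes at stage \<open>to_nat \<phi>\<close>.\<close>

primrec henkin ::
  "('f::countable, 'r::countable) sig \<Rightarrow> ('f, 'r) fm set \<Rightarrow> nat \<Rightarrow> ('f, 'r) fm set" where
  "henkin \<Sigma> \<Gamma> 0 = \<Gamma>"
| "henkin \<Sigma> \<Gamma> (Suc n) =
     (if wf_fm \<Sigma> (from_nat n) \<and> \<not> deriv \<Sigma> (insert (from_nat n) (henkin \<Sigma> \<Gamma> n)) Bot
      then add_witness (from_nat n) (henkin \<Sigma> \<Gamma> n) else henkin \<Sigma> \<Gamma> n)"

text \<open>The invariant that guarantees a fresh variable at every stage.\<close>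

lemma finite_fv_add_witness:
  assumes "finite (\<Union> (fv_fm ` \<Gamma>))"
  shows "finite (\<Union> (fv_fm ` add_witness \<psi> \<Gamma>))"
proof -
  have "finite {Neg (inst \<phi> (Var (fresh (insert \<psi> \<Gamma>) \<phi>))) |\<phi>. \<psi> = Neg (All \<phi>)}" (is "finite ?W")
    by (cases "\<exists>\<phi>. \<psi> = Neg (All \<phi>)") auto
  then have "finite (\<Union> (fv_fm ` ?W))" using finite_fv_fm by blast
  with assms show ?thesis by (simp add: add_witness_def image_Un finite_fv_fm)
qed

lemma consistent_add_witness:
  assumes "finite (\<Union> (fv_fm ` \<Gamma>))" "wf_fm \<Sigma> \<psi>" "\<not> deriv \<Sigma> (insert \<psi> \<Gamma>) Bot"
  shows "\<not> deriv \<Sigma> (add_witness \<psi> \<Gamma>) Bot"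
proof (cases "\<exists>\<phi>. \<psi> = Neg (All \<phi>)")
  case True
  then obtain \<phi> where \<psi>: "\<psi> = Neg (All \<phi>)" by blast
  let ?\<Gamma> = "insert \<psi> \<Gamma>"
  have "finite (\<Union> (fv_fm ` ?\<Gamma>))" using assms(1) finite_fv_fm by simp
  from fresh[OF this, of \<phi>]
  have "\<not> deriv \<Sigma> (insert (Neg (inst \<phi> (Var (fresh ?\<Gamma> \<phi>)))) ?\<Gamma>) Bot"
    using assms \<psi> by (intro deriv_witness) auto
  moreover have "add_witness \<psi> \<Gamma> = insert (Neg (inst \<phi> (Var (fresh ?\<Gamma> \<phi>)))) ?\<Gamma>"
    using \<psi> by (auto simp: add_witness_def)
  ultimately show ?thesis by simp
next
  case False
  with assms show ?thesis by (simp add: add_witness_def)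
qed

lemma saturated_extension:
  fixes \<Sigma> :: "('f::countable, 'r::countable) sig"
  assumes wf: "\<And>\<gamma>. \<gamma> \<in> \<Gamma> \<Longrightarrow> wf_fm \<Sigma> \<gamma>" and fv: "finite (\<Union> (fv_fm ` \<Gamma>))"
    and cons: "\<not> deriv \<Sigma> \<Gamma> Bot"
  obtains H where "\<Gamma> \<subseteq> H" "saturated \<Sigma> H"
proof
  let ?h = "henkin \<Sigma> \<Gamma>"
  let ?H = "\<Union>n. ?h n"
  have mono: "?h m \<subseteq> ?h n" if "m \<le> n" for m n
    using that by (rule lift_Suc_mono_le[rotated]) (auto simp: add_witness_def)
  have fin: "finite (\<Union> (fv_fm ` ?h n))" for n
    by (induction n) (simp_all add: fv finite_fv_add_witness)
  have cons_h: "\<not> deriv \<Sigma> (?h n) Bot" for n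
    by (induction n) (simp_all add: cons consistent_add_witness[OF fin])
  have wf_h: "\<phi> \<in> ?h n \<Longrightarrow> wf_fm \<Sigma> \<phi>" for n \<phi>
    by (induction n) (auto simp: wf add_witness_def wf_fm_inst split: if_splits)
  show "\<Gamma> \<subseteq> ?H" by (metis UN_upper UNIV_I henkin.simps(1))
  \<comment> \<open>A derivation uses finitely many assumptions, and these already occur together at
    one stage of the increasing chain.\<close>
  have cons_H: "\<not> deriv \<Sigma> ?H Bot"
  proof
    assume "deriv \<Sigma> ?H Bot"
    from deriv_compact[OF this]
    obtain \<Delta> where \<Delta>: "\<Delta> \<subseteq> ?H" "finite \<Delta>" "deriv \<Sigma> \<Delta> Bot" by (elim exE conjE)
    from \<Delta>(2,1) have "\<exists>n. \<Delta> \<subseteq> ?h n"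
    proof (induction rule: finite_induct)
      case (insert \<phi> \<Delta>)
      then obtain m n where "\<phi> \<in> ?h m" "\<Delta> \<subseteq> ?h n" by blast
      then have "insert \<phi> \<Delta> \<subseteq> ?h (max m n)" using mono[of m "max m n"] mono[of n "max m n"] by auto
      then show ?case ..
    qed simp
    then show False using \<Delta>(3) cons_h deriv_mono by blast
  qed
  \<comment> \<open>A formula consistent with the limit is consistent with every stage, so it was
    accepted, with its witness, when its turn came.\<close>
  have added: "add_witness \<phi> (?h (to_nat \<phi>)) \<subseteq> ?H"
    if "wf_fm \<Sigma> \<phi>" "\<not> deriv \<Sigma> (insert \<phi> ?H) Bot" for \<phi>
  proof -
    have "\<not> deriv \<Sigma> (insert \<phi> (?h (to_nat \<phi>))) Bot"
      using that(2) by (metis UN_upper UNIV_I deriv_mono insert_mono)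
    then have "add_witness \<phi> (?h (to_nat \<phi>)) = ?h (Suc (to_nat \<phi>))" using that(1) by simp
    then show ?thesis by blast
  qed
  show "saturated \<Sigma> ?H"
  proof
    show "wf_fm \<Sigma> \<phi>" if "\<phi> \<in> ?H" for \<phi> using that wf_h by blast
    show "\<not> deriv \<Sigma> ?H Bot" by (rule cons_H)
    show "deriv \<Sigma> (insert \<phi> ?H) Bot" if "wf_fm \<Sigma> \<phi>" "\<phi> \<notin> ?H" for \<phi>
      using added[OF that(1)] that(2) by (auto simp: add_witness_def)
    \<comment> \<open>The formula may have entered through \<open>\<Gamma>\<close> or as a witness,
      before its own turn. As a member of the consistent limit it is still accepted at its turn, and
      only then is its witness certain to be present.\<close>
    show "\<exists>k. Neg (inst \<phi> (Var k)) \<in> ?H" if "Neg (All \<phi>) \<in> ?H" for \<phi>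
    proof -
      have "wf_fm \<Sigma> (Neg (All \<phi>))" using that wf_h by blast
      moreover have "insert (Neg (All \<phi>)) ?H = ?H" using that by blast
      ultimately have "add_witness (Neg (All \<phi>)) (?h (to_nat (Neg (All \<phi>)))) \<subseteq> ?H"
        using added[of "Neg (All \<phi>)"] cons_H by (simp only: not_False_eq_True simp_thms)
      then show ?thesis by (auto simp: add_witness_def)
    qed
  qed
qed

text \<open>If \<open>\<phi>\<close> is not derivable, \<open>\<Gamma>\<close> with
  \<open>Neg \<phi>\<close> is consistent and extends to a saturated set, whose term model is a
  countermodel. Hence it suffices to consider carriers consisting of sets of terms.\<close>

theorem completeness:
  fixes \<Sigma> :: "('f::countable, 'r::countable) sig"
  assumes "\<And>\<gamma>. \<gamma> \<in> \<Gamma> \<Longrightarrow> wf_fm \<Sigma> \<gamma> \<and> fv_fm \<gamma> = {}" and "wf_fm \<Sigma> \<phi>"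
    and "\<And>(U :: 'f tm set set) F R e. is_structure \<Sigma> U F \<Longrightarrow> range e \<subseteq> U \<Longrightarrow>
      (\<And>\<gamma>. \<gamma> \<in> \<Gamma> \<Longrightarrow> sat U F R e \<gamma>) \<Longrightarrow> sat U F R e \<phi>"
  shows "deriv \<Sigma> \<Gamma> \<phi>"
proof (rule Raa[OF assms(2)], rule ccontr)
  let ?\<Gamma> = "insert (Neg \<phi>) \<Gamma>"
  assume "\<not> deriv \<Sigma> ?\<Gamma> Bot"
  moreover have "wf_fm \<Sigma> \<gamma>" if "\<gamma> \<in> ?\<Gamma>" for \<gamma> using that assms by auto
  moreover have "finite (\<Union> (fv_fm ` ?\<Gamma>))" using assms(1) finite_fv_fm[of \<phi>] by simp
  ultimately obtain H where H: "?\<Gamma> \<subseteq> H" "saturated \<Sigma> H" using saturated_extension by blast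
  interpret saturated \<Sigma> H by (rule H(2))
  have "sat term_univ term_fun term_rel (\<lambda>i. cls (Var i)) \<phi>"
  proof (intro assms(3) is_structure_term)
    show "range (\<lambda>i. cls (Var i)) \<subseteq> term_univ" by (auto simp: term_univ_def)
    show "sat term_univ term_fun term_rel (\<lambda>i. cls (Var i)) \<gamma>" if "\<gamma> \<in> \<Gamma>" for \<gamma>
      using that assms(1) H(1) sat_term_Var by blast
  qed
  then have "\<phi> \<in> H" using assms(2) sat_term_Var by blast
  moreover have "Neg \<phi> \<in> H" using H(1) by blast
  ultimately show False using Imp_mem[of \<phi> Bot] assms(2) Bot_notin by simp
qed


section \<open>Translated structures\<close>

definition append_env :: "'u list \<Rightarrow> (nat \<Rightarrow> 'u) \<Rightarrow> nat \<Rightarrow> 'u" where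
  "append_env xs e i = (if i < length xs then xs ! i else e (i - length xs))"

lemma append_env_Nil [simp]: "append_env [] e = e"
  by (auto simp: append_env_def)

lemma append_env_Cons: "append_env (x # xs) e = case_nat x (append_env xs e)"
  by (rule ext) (auto simp: append_env_def split: nat.split intro!: arg_cong[of _ _ e])

text \<open>The outermost quantifier of a block binds the highest index, so peeling it off adds its
  value at the end of the list.\<close>

lemma append_env_snoc: "append_env (xs @ [x]) e = append_env xs (case_nat x e)"
proof
  fix i
  consider "i < length xs" | "i = length xs" | j where "i = length xs + Suc j"
    by (metis add_Suc_right less_imp_Suc_add linorder_neqE_nat)
  then show "append_env (xs @ [x]) e i = append_env xs (case_nat x e) i"
    by cases (simp_all add: append_env_def nth_append)
qed

lemma sat_All_n:
  "sat U F R e (All_n n \<phi>) \<longleftrightarrow> (\<forall>xs. length xs = n \<longrightarrow> set xs \<subseteq> U \<longrightarrow> sat U F R (append_env xs e) \<phi>)"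
proof (induction n arbitrary: e)
  case (Suc n)
  have "sat U F R e (All_n (Suc n) \<phi>) \<longleftrightarrow>
      (\<forall>x\<in>U. \<forall>xs. length xs = n \<longrightarrow> set xs \<subseteq> U \<longrightarrow> sat U F R (append_env (xs @ [x]) e) \<phi>)"
    using Suc by (simp add: All_n_def append_env_snoc)
  also have "\<dots> \<longleftrightarrow> (\<forall>xs. length xs = Suc n \<longrightarrow> set xs \<subseteq> U \<longrightarrow> sat U F R (append_env xs e) \<phi>)"
    by (auto simp: length_Suc_conv_rev)
  finally show ?case .
qed (simp add: All_n_def)

lemma sat_Exi_n:
  "sat U F R e (Exi_n n \<phi>) \<longleftrightarrow> (\<exists>xs. length xs = n \<and> set xs \<subseteq> U \<and> sat U F R (append_env xs e) \<phi>)"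
proof -
  have "sat U F R e (Exi_n n \<phi>) \<longleftrightarrow> \<not> sat U F R e (All_n n (Neg \<phi>))" for e
    by (induction n arbitrary: e) (simp_all add: All_n_def Exi_n_def)
  then show ?thesis by (auto simp: sat_All_n)
qed

lemma wf_Conj: "wf_fm \<Sigma> (Conj \<phi>s) \<longleftrightarrow> (\<forall>\<phi>\<in>set \<phi>s. wf_fm \<Sigma> \<phi>)"
  by (induction \<phi>s) (auto simp: Conj_def)

lemma wf_Disj: "wf_fm \<Sigma> (Disj \<phi>s) \<longleftrightarrow> (\<forall>\<phi>\<in>set \<phi>s. wf_fm \<Sigma> \<phi>)"
  by (induction \<phi>s) (auto simp: Disj_def)

lemma fv_Disj: "fv_fm (Disj \<phi>s) = (\<Union>\<phi>\<in>set \<phi>s. fv_fm \<phi>)"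
  by (induction \<phi>s) (auto simp: Disj_def)

lemma wf_All_n: "wf_fm \<Sigma> (All_n n \<phi>) \<longleftrightarrow> wf_fm \<Sigma> \<phi>"
  by (induction n) (auto simp: All_n_def)

lemma wf_Exi_n: "wf_fm \<Sigma> (Exi_n n \<phi>) \<longleftrightarrow> wf_fm \<Sigma> \<phi>"
  by (induction n) (auto simp: Exi_n_def)

lemma wf_unnest:
  assumes "wf_fm \<Sigma> (dom_tr \<tau>)" "\<And>g. g \<in> set gs \<Longrightarrow> wf_fm \<Sigma> g" "wf_fm \<Sigma> \<psi>"
  shows "wf_fm \<Sigma> (unnest \<tau> k gs \<psi>)"
  using assms by (auto simp: unnest_def wf_Exi_n wf_Conj in_dom_def wf_fm_subst)

lemma wf_tr_tm:
  "wf_translation \<Sigma> \<Sigma>' \<tau> \<Longrightarrow> wf_tm \<Sigma> t \<Longrightarrow> wf_fm \<Sigma>' (tr_tm \<tau> t)"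
  by (induction t) (auto simp: wf_translation_def list_all_iff intro!: wf_unnest)

lemma wf_tr_fm:
  "wf_translation \<Sigma> \<Sigma>' \<tau> \<Longrightarrow> wf_fm \<Sigma> \<phi> \<Longrightarrow> wf_fm \<Sigma>' (tr_fm \<tau> \<phi>)"
proof (induction \<phi>)
  case (Eq s t)
  then show ?case using wf_tr_tm[OF Eq.prems(1)]
    by (auto simp: wf_translation_def intro!: wf_unnest)
next
  case (Rel r ts)
  then show ?case using wf_tr_tm[OF Rel.prems(1)]
    by (auto simp: wf_translation_def list_all_iff intro!: wf_unnest)
qed (auto simp: wf_translation_def)

lemma wf_functional:
  "wf_fm \<Sigma> (dom_tr \<tau>) \<Longrightarrow> wf_fm \<Sigma> \<phi> \<Longrightarrow> wf_fm \<Sigma> (functional \<tau> n \<phi>)"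
  by (auto simp: functional_def wf_All_n wf_Conj in_dom_def wf_fm_subst)

text \<open>The semantic side of a translation: inside \<open>(U, F, R)\<close> its formulas define
  the structure \<open>(U', F', R')\<close>. In an assignment the arguments come first, followed for
  function symbols by the value; all later entries are arbitrary.\<close>

locale translated_structure =
  fixes \<Sigma> :: "('f, 'r) sig" and \<tau> :: "('f, 'r, 'g, 's) translation"
    and U :: "'u set" and F :: "'g \<Rightarrow> 'u list \<Rightarrow> 'u" and R :: "'s \<Rightarrow> 'u list \<Rightarrow> bool"
    and U' :: "'u set" and F' :: "'f \<Rightarrow> 'u list \<Rightarrow> 'u" and R' :: "'r \<Rightarrow> 'u list \<Rightarrow> bool"
  assumes is_structure: "is_structure \<Sigma> U' F'" and subset: "U' \<subseteq> U"
    and sat_dom: "\<And>e. e 0 \<in> U \<Longrightarrow> sat U F R e (dom_tr \<tau>) \<longleftrightarrow> e 0 \<in> U'"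
    and sat_fun: "\<And>f xs a e. fun_arity \<Sigma> f = Some (length xs) \<Longrightarrow> set xs \<subseteq> U' \<Longrightarrow> a \<in> U' \<Longrightarrow>
      sat U F R (append_env xs (case_nat a e)) (fun_tr \<tau> f) \<longleftrightarrow> a = F' f xs"
    and sat_rel: "\<And>r xs e. rel_arity \<Sigma> r = Some (length xs) \<Longrightarrow> set xs \<subseteq> U' \<Longrightarrow>
      sat U F R (append_env xs e) (rel_tr \<tau> r) \<longleftrightarrow> R' r xs"
begin

lemma sat_in_dom: "e i \<in> U \<Longrightarrow> sat U F R e (in_dom \<tau> i) \<longleftrightarrow> e i \<in> U'"
  by (simp add: in_dom_def sat_subst sat_dom)

lemma sat_unnest:
  "sat U F R e (unnest \<tau> k gs \<psi>) \<longleftrightarrow>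
     (\<exists>xs. length xs = length gs \<and> set xs \<subseteq> U' \<and>
       (\<forall>i<length gs. sat U F R (case_nat (xs ! i) (\<lambda>j. e (j + k))) (gs ! i)) \<and>
       sat U F R (append_env xs e) \<psi>)"
proof -
  let ?n = "length gs"
  \<comment> \<open>The renaming in \<open>unnest\<close> sends variable 0 of an argument formula to
    its slot \<open>i\<close> in the block and moves the others past the block and the
    \<open>k\<close> skipped variables.\<close>
  have env: "(\<lambda>j. eval F (append_env xs e) (Var (case_nat i (\<lambda>j. j + k + ?n) j))) =
      case_nat (xs ! i) (\<lambda>j. e (j + k))" if "length xs = ?n" "i < ?n" for xs i
    using that by (auto simp: append_env_def split: nat.split)
  have arg: "sat U F R (append_env xs e)
        (in_dom \<tau> i \<^bold>\<and> rename_fm (case_nat i (\<lambda>j. j + k + ?n)) (gs ! i)) \<longleftrightarrow>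
      xs ! i \<in> U' \<and> sat U F R (case_nat (xs ! i) (\<lambda>j. e (j + k))) (gs ! i)"
    if "length xs = ?n" "set xs \<subseteq> U" "i < ?n" for xs i
  proof -
    have "append_env xs e i = xs ! i" "xs ! i \<in> U" using that by (auto simp: append_env_def)
    then show ?thesis using that env sat_in_dom[of "append_env xs e" i] by (simp add: sat_subst)
  qed
  have "sat U F R e (unnest \<tau> k gs \<psi>) \<longleftrightarrow>
     (\<exists>xs. length xs = ?n \<and> set xs \<subseteq> U \<and>
       (\<forall>i<?n. sat U F R (append_env xs e)
          (in_dom \<tau> i \<^bold>\<and> rename_fm (case_nat i (\<lambda>j. j + k + ?n)) (gs ! i))) \<and>
       sat U F R (append_env xs e) \<psi>)"
    by (simp add: unnest_def sat_Exi_n sat_Conj, simp add: Ball_def)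
  also have "\<dots> \<longleftrightarrow> (\<exists>xs. length xs = ?n \<and> set xs \<subseteq> U \<and>
       (\<forall>i<?n. xs ! i \<in> U' \<and> sat U F R (case_nat (xs ! i) (\<lambda>j. e (j + k))) (gs ! i)) \<and>
       sat U F R (append_env xs e) \<psi>)"
    using arg by (intro ex_cong1 conj_cong refl) (simp del: sat.simps)
  also have "\<dots> \<longleftrightarrow> (\<exists>xs. length xs = ?n \<and> set xs \<subseteq> U' \<and>
       (\<forall>i<?n. sat U F R (case_nat (xs ! i) (\<lambda>j. e (j + k))) (gs ! i)) \<and>
       sat U F R (append_env xs e) \<psi>)"
    using subset by (intro ex_cong1) (auto simp: subset_eq all_set_conv_all_nth)
  finally show ?thesis .
qed

lemma eval_in:
  "wf_tm \<Sigma> t \<Longrightarrow> (\<And>i. i \<in> fv_tm t \<Longrightarrow> e i \<in> U') \<Longrightarrow> eval F' e t \<in> U'"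
proof (induction t)
  case (Fn f ts)
  then have "set (map (eval F' e) ts) \<subseteq> U'" by (force simp: list_all_iff)
  then show ?case using is_structure Fn.prems by (simp add: is_structure_def)
qed simp

lemma args_unique:
  assumes "length gs = length ts" "length xs = length ts" "set xs \<subseteq> U'"
    and "\<And>i a. i < length ts \<Longrightarrow> a \<in> U' \<Longrightarrow>
      sat U F R (case_nat a e) (gs ! i) \<longleftrightarrow> a = eval F' e' (ts ! i)"
  shows "(\<forall>i<length gs. sat U F R (case_nat (xs ! i) e) (gs ! i)) \<longleftrightarrow> xs = map (eval F' e') ts"
proof -
  have "xs ! i \<in> U'" if "i < length ts" for i using that assms(2,3) by auto
  with assms show ?thesis by (auto simp: list_eq_iff_nth_eq)
qed

text \<open>Each argument formula pins down its value within \<open>U'\<close>, so the list of these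
  values is the only possible witness for the existential block.\<close>

lemma sat_unnest_args:
  assumes "length gs = length ts" "\<And>t. t \<in> set ts \<Longrightarrow> eval F' e' t \<in> U'"
    and "\<And>i a. i < length ts \<Longrightarrow> a \<in> U' \<Longrightarrow>
      sat U F R (case_nat a (\<lambda>j. e (j + k))) (gs ! i) \<longleftrightarrow> a = eval F' e' (ts ! i)"
  shows "sat U F R e (unnest \<tau> k gs \<psi>) \<longleftrightarrow> sat U F R (append_env (map (eval F' e') ts) e) \<psi>"
proof -
  have "length xs = length gs \<and> set xs \<subseteq> U' \<and>
       (\<forall>i<length gs. sat U F R (case_nat (xs ! i) (\<lambda>j. e (j + k))) (gs ! i)) \<and>
       sat U F R (append_env xs e) \<psi> \<longleftrightarrow>
      xs = map (eval F' e') ts \<and> sat U F R (append_env xs e) \<psi>" for xs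
    using args_unique[of gs ts xs "\<lambda>j. e (j + k)" e'] assms by auto
  then show ?thesis unfolding sat_unnest by simp
qed

lemma sat_tr_tm:
  assumes "wf_tm \<Sigma> t" "\<And>i. i \<in> fv_tm t \<Longrightarrow> e i \<in> U'" "a \<in> U'"
  shows "sat U F R (case_nat a e) (tr_tm \<tau> t) \<longleftrightarrow> a = eval F' e t"
  using assms
proof (induction t arbitrary: a)
  case (Fn f ts)
  have wf: "\<And>t. t \<in> set ts \<Longrightarrow> wf_tm \<Sigma> t" using Fn.prems by (simp add: list_all_iff)
  have ev: "eval F' e t \<in> U'" if "t \<in> set ts" for t
    using that wf Fn.prems(2) by (intro eval_in) auto
  \<comment> \<open>The offset 1 skips the value \<open>a\<close>, so the argument formulas are read
    under \<open>e\<close> itself.\<close>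
  have *: "sat U F R (case_nat b (\<lambda>j. case_nat a e (j + 1))) (map (tr_tm \<tau>) ts ! i) \<longleftrightarrow>
      b = eval F' e (ts ! i)" if "i < length ts" "b \<in> U'" for i b
    using Fn.IH[OF nth_mem[OF that(1)], of b] wf[OF nth_mem] Fn.prems(2) that by force
  have "sat U F R (case_nat a e) (tr_tm \<tau> (Fn f ts)) \<longleftrightarrow>
      sat U F R (append_env (map (eval F' e) ts) (case_nat a e)) (fun_tr \<tau> f)"
    unfolding tr_tm.simps by (rule sat_unnest_args) (use ev * in simp_all)
  also have "\<dots> \<longleftrightarrow> a = eval F' e (Fn f ts)"
    using Fn.prems ev by (subst sat_fun) auto
  finally show ?case .
qed simp

lemma sat_tr_fm:
  assumes "wf_fm \<Sigma> \<phi>" "\<And>i. i \<in> fv_fm \<phi> \<Longrightarrow> e i \<in> U'"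
  shows "sat U F R e (tr_fm \<tau> \<phi>) \<longleftrightarrow> sat U' F' R' e \<phi>"
  using assms
proof (induction \<phi> arbitrary: e)
  case (Eq s t)
  have *: "sat U F R (case_nat a (\<lambda>j. e (j + 0))) ([tr_tm \<tau> s, tr_tm \<tau> t] ! i) \<longleftrightarrow>
      a = eval F' e ([s, t] ! i)" if "i < length [s, t]" "a \<in> U'" for i a
  proof -
    have "sat U F R (case_nat a e) (tr_tm \<tau> s) \<longleftrightarrow> a = eval F' e s"
      "sat U F R (case_nat a e) (tr_tm \<tau> t) \<longleftrightarrow> a = eval F' e t"
      using Eq.prems that(2) sat_tr_tm[of s e a] sat_tr_tm[of t e a] by simp_all
    moreover from that(1) have "i = 0 \<or> i = Suc 0" by auto
    ultimately show ?thesis by (elim disjE) simp_all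
  qed
  have "sat U F R e (tr_fm \<tau> (s \<^bold>= t)) \<longleftrightarrow>
      sat U F R (append_env (map (eval F' e) [s, t]) e) (Var 0 \<^bold>= Var 1)"
    unfolding tr_fm.simps
  proof (rule sat_unnest_args)
    show "eval F' e u \<in> U'" if "u \<in> set [s, t]" for u
      using that Eq.prems eval_in[of u e] by auto
  qed (simp, rule *)
  then show ?case by (simp add: append_env_Cons)
next
  case (Rel r ts)
  have ev: "eval F' e t \<in> U'" if "t \<in> set ts" for t
    using that Rel.prems by (intro eval_in) (auto simp: list_all_iff)
  have *: "sat U F R (case_nat b (\<lambda>j. e (j + 0))) (map (tr_tm \<tau>) ts ! i) \<longleftrightarrow>
      b = eval F' e (ts ! i)" if "i < length ts" "b \<in> U'" for i b
    using sat_tr_tm[of "ts ! i" e b] nth_mem[OF that(1)] that Rel.prems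
    by (force simp: list_all_iff)
  have "sat U F R e (tr_fm \<tau> (Rel r ts)) \<longleftrightarrow>
      sat U F R (append_env (map (eval F' e) ts) e) (rel_tr \<tau> r)"
    unfolding tr_fm.simps by (rule sat_unnest_args) (use ev * in simp_all)
  also have "\<dots> \<longleftrightarrow> sat U' F' R' e (Rel r ts)"
    using Rel.prems ev by (subst sat_rel) auto
  finally show ?case .
next
  case (Imp \<phi> \<psi>)
  then show ?case by simp
next
  case (All \<phi>)
  have "sat U F R (case_nat x e) (tr_fm \<tau> \<phi>) \<longleftrightarrow> sat U' F' R' (case_nat x e) \<phi>" if "x \<in> U'" for x
    using All that by (intro All.IH) (auto split: nat.split)
  then show ?case using subset by (auto simp: sat_dom)
qed simp

lemma sat_functional:
  assumes "fun_arity \<Sigma> f = Some n"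
  shows "sat U F R e (functional \<tau> n (fun_tr \<tau> f))"
proof -
  have "sat U F R (append_env xs e) (Exi (in_dom \<tau> 0 \<^bold>\<and>
         All (in_dom \<tau> 0 \<^bold>\<longrightarrow>
           (rename_fm (\<lambda>i. if i < n then i + 2 else 0) (fun_tr \<tau> f) \<^bold>\<longleftrightarrow> Var 0 \<^bold>= Var 1))))"
    if xs: "length xs = n" "set xs \<subseteq> U'" for xs
  proof -
    have mem: "F' f xs \<in> U'" using xs assms is_structure by (simp add: is_structure_def)
    \<comment> \<open>The renaming identifies all indices from \<open>n\<close> on with the
      candidate value \<open>b\<close>, which produces a constant tail; \<open>sat_fun\<close>
      applies with any tail.\<close>
    have "(\<lambda>i. eval F (case_nat b (case_nat v (append_env xs e)))
         (Var (if i < n then i + 2 else 0))) = append_env xs (case_nat b (\<lambda>_. b))" for b v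
      using xs by (auto simp: append_env_def split: nat.split)
    then have "sat U F R (case_nat b (case_nat (F' f xs) (append_env xs e)))
        (rename_fm (\<lambda>i. if i < n then i + 2 else 0) (fun_tr \<tau> f)) \<longleftrightarrow> b = F' f xs"
      if "b \<in> U'" for b
      using sat_fun[of f xs b] that xs assms by (simp add: sat_subst)
    then show ?thesis using mem subset by (auto simp: sat_in_dom intro!: bexI[of _ "F' f xs"])
  qed
  moreover have "set xs \<subseteq> U'"
    if xs: "length xs = n" "set xs \<subseteq> U" "\<forall>i<n. sat U F R (append_env xs e) (in_dom \<tau> i)" for xs
  proof -
    have "xs ! i \<in> U'" if "i < n" for i
    proof -
      have "append_env xs e i = xs ! i" "xs ! i \<in> U" using that xs by (auto simp: append_env_def)
      then show ?thesis using that xs(3) sat_in_dom[of "append_env xs e" i] by simp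
    qed
    then show ?thesis using xs(1) by (auto simp: in_set_conv_nth)
  qed
  ultimately show ?thesis
    unfolding functional_def sat_All_n by (auto simp: sat_Conj simp del: sat.simps(5))
qed

end

text \<open>Completeness turns every derivability condition of \<open>interprets\<close> into truth
  in all models of \<open>S\<close>. In each model, one defined structure settles all of
  them.\<close>

theorem interpretsI:
  fixes \<tau> :: "('f, 'r, 'g::countable, 's::countable) translation"
  assumes "wf_translation \<Sigma> \<Sigma>' \<tau>"
    and "\<And>\<gamma>. \<gamma> \<in> S \<Longrightarrow> wf_fm \<Sigma>' \<gamma> \<and> fv_fm \<gamma> = {}"
    and "\<And>\<phi>. \<phi> \<in> T \<Longrightarrow> wf_fm \<Sigma> \<phi> \<and> fv_fm \<phi> = {}"
    and model: "\<And>(U :: 'g tm set set) F R e. is_structure \<Sigma>' U F \<Longrightarrow>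
      (\<And>\<gamma>. \<gamma> \<in> S \<Longrightarrow> sat U F R e \<gamma>) \<Longrightarrow>
      \<exists>U' F' R'. translated_structure \<Sigma> \<tau> U F R U' F' R' \<and> (\<forall>\<phi>\<in>T. sat U' F' R' e \<phi>)"
  shows "interprets \<Sigma>' S \<Sigma> T"
  unfolding interprets_def
proof (intro exI[of _ \<tau>] conjI allI impI ballI)
  show "wf_translation \<Sigma> \<Sigma>' \<tau>" by (rule assms(1))
  have wf_dom: "wf_fm \<Sigma>' (dom_tr \<tau>)" using assms(1) by (simp add: wf_translation_def)
  show "deriv \<Sigma>' S (Exi (dom_tr \<tau>))"
  proof (rule completeness[OF assms(2)])
    fix U :: "'g tm set set" and F R e
    assume "is_structure \<Sigma>' U F" "\<And>\<gamma>. \<gamma> \<in> S \<Longrightarrow> sat U F R e \<gamma>"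
    then obtain U' F' R' where ts: "translated_structure \<Sigma> \<tau> U F R U' F' R'"
      using model by metis
    obtain x where "x \<in> U'"
      using translated_structure.is_structure[OF ts] by (auto simp: is_structure_def)
    then show "sat U F R e (Exi (dom_tr \<tau>))"
      using translated_structure.subset[OF ts] translated_structure.sat_dom[OF ts] by auto
  qed (use wf_dom in auto)
  show "deriv \<Sigma>' S (functional \<tau> n (fun_tr \<tau> f))" if "fun_arity \<Sigma> f = Some n" for f n
  proof (rule completeness[OF assms(2)])
    show "wf_fm \<Sigma>' (functional \<tau> n (fun_tr \<tau> f))"
      using that assms(1) by (auto simp: wf_translation_def intro: wf_functional)
    fix U :: "'g tm set set" and F R e
    assume "is_structure \<Sigma>' U F" "\<And>\<gamma>. \<gamma> \<in> S \<Longrightarrow> sat U F R e \<gamma>"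
    then obtain U' F' R' where "translated_structure \<Sigma> \<tau> U F R U' F' R'"
      using model by metis
    then show "sat U F R e (functional \<tau> n (fun_tr \<tau> f))"
      using that by (rule translated_structure.sat_functional)
  qed
  show "deriv \<Sigma>' S (tr_fm \<tau> \<phi>)" if "\<phi> \<in> T" for \<phi>
  proof (rule completeness[OF assms(2)])
    show "wf_fm \<Sigma>' (tr_fm \<tau> \<phi>)" using that assms(1,3) wf_tr_fm by blast
    fix U :: "'g tm set set" and F R e
    assume "is_structure \<Sigma>' U F" "\<And>\<gamma>. \<gamma> \<in> S \<Longrightarrow> sat U F R e \<gamma>"
    then obtain U' F' R' where "translated_structure \<Sigma> \<tau> U F R U' F' R'"
      "sat U' F' R' e \<phi>"
      using model \<open>\<phi> \<in> T\<close> by metis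
    then show "sat U F R e (tr_fm \<tau> \<phi>)"
      using translated_structure.sat_tr_fm assms(3)[OF that] by (metis empty_iff)
  qed
qed


instance letter :: countable by countable_datatype
instance vw_fun :: countable by countable_datatype
instance vw_rel :: countable by countable_datatype

section \<open>Concatenation in models of \<open>VW\<^sup>+\<close>\<close>

abbreviation twos :: "nat \<Rightarrow> letter list" where
  "twos m \<equiv> replicate m Two"

lemma vw_arity [simp]:
  "fun_arity vw_sig Vw_e = Some 0" "fun_arity vw_sig (Vw_S d) = Some 1"
  "fun_arity vw_sig Vw_f = Some 1" "rel_arity vw_sig r = Some 2"
  by (simp_all add: vw_sig_def)

lemma wd_arity [simp]:
  "fun_arity wd_sig s = (if s = [] then None else Some 0)"
  "rel_arity wd_sig Wd_le = Some 2" "rel_arity wd_sig Wd_C = Some 3"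
  by (simp_all add: wd_sig_def)

lemma wf_canon [simp]: "wf_tm vw_sig (canon w)"
  by (induction w rule: rev_induct) (simp_all add: canon_simps)

lemma fv_canon [simp]: "fv_tm (canon w) = {}"
  by (induction w rule: rev_induct) (simp_all add: canon_simps)

lemma VW_plus_sentence: "\<gamma> \<in> VW_plus \<Longrightarrow> wf_fm vw_sig \<gamma> \<and> fv_fm \<gamma> = {}"
  by (cases rule: VW_plus.cases) (auto simp: wf_Disj fv_Disj split: if_splits)

lemma WD_R_sentence: "\<phi> \<in> WD_R \<Longrightarrow> wf_fm wd_sig \<phi> \<and> fv_fm \<phi> = {}"
  by (cases rule: WD_R.cases) (auto simp: wf_Disj fv_Disj set_wd_initial split: if_splits)

section \<open>Formulas defining concatenation, and the translation\<close>

definition tally_fm :: "nat \<Rightarrow> (vw_fun, vw_rel) fm" where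
  "tally_fm n = (vw_init vw_e (Var n) \<^bold>\<and>
     All (vw_init (Var 0) (Var (Suc n)) \<^bold>\<and> Neg (Var 0 \<^bold>= Var (Suc n)) \<^bold>\<longrightarrow>
          vw_init (vw_S Two (Var 0)) (Var (Suc n))))"

text \<open>
  For a nonempty word \<open>y\<close>, asking that \<open>|y| \<le> j + 1\<close> rather than \<open>|y| \<le> j\<close> makes room for the letter
  \<open>One\<close> that marks the border, so that the least possible length is \<open>|x| + |y|\<close> exactly.
\<close>

definition fits_fm :: "nat \<Rightarrow> nat \<Rightarrow> nat \<Rightarrow> (vw_fun, vw_rel) fm" where
  "fits_fm n x y =
     Exi (Exi (Exi (vw_init (Var 2) (Var (n + 3)) \<^bold>\<and> vw_init (Var 1) (Var (n + 3)) \<^bold>\<and>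
       vw_len (Var 0) (Var (n + 3)) \<^bold>\<and>
       vw_len (Var (x + 3)) (Var 2) \<^bold>\<and> vw_len (Var (y + 3)) (vw_S Two (Var 1)) \<^bold>\<and>
       vw_init (vw_S One (Var 2)) (Var 0) \<^bold>\<and> vw_init (Var 1) (vw_f (Var 0)))))"

text \<open>Final segments are expressed as initial segments of reversals. The minimality clause has
  two tasks: excluding \<open>fits_fm\<close> below the tally fixes the tally as the sum of the
  lengths, and excluding \<open>vw_len\<close> below it gives the third word exactly that
  length.\<close>

definition conc_fm :: "nat \<Rightarrow> nat \<Rightarrow> nat \<Rightarrow> (vw_fun, vw_rel) fm" where
  "conc_fm x y z =
     Exi (tally_fm 0 \<^bold>\<and> fits_fm 0 (Suc x) (Suc y) \<^bold>\<and> vw_len (Var (Suc z)) (Var 0) \<^bold>\<and>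
       vw_init (Var (Suc x)) (Var (Suc z)) \<^bold>\<and>
       vw_init (vw_f (Var (Suc y))) (vw_f (Var (Suc z))) \<^bold>\<and>
       All (vw_init (Var 0) (Var 1) \<^bold>\<and> Neg (Var 0 \<^bold>= Var 1) \<^bold>\<longrightarrow>
         Neg (fits_fm 0 (x + 2) (y + 2)) \<^bold>\<and> Neg (vw_len (Var (z + 2)) (Var 0))))"

definition unique_conc_fm :: "nat \<Rightarrow> nat \<Rightarrow> nat \<Rightarrow> (vw_fun, vw_rel) fm" where
  "unique_conc_fm x y z =
     (conc_fm x y z \<^bold>\<and> All (conc_fm (Suc x) (Suc y) 0 \<^bold>\<longrightarrow> Var 0 \<^bold>= Var (Suc z)))"

text \<open>\<open>WD4\<close> and \<open>WD5\<close> speak about all elements, including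
  nonstandard ones, so totality and functionality are enforced by the shape of the
  definition.\<close>

definition wd_C_fm :: "(vw_fun, vw_rel) fm" where
  "wd_C_fm = (unique_conc_fm 0 1 2 \<^bold>\<or> Neg (Exi (unique_conc_fm 1 2 0)) \<^bold>\<and> Var 2 \<^bold>= Var 0)"

definition code :: "bool list \<Rightarrow> letter list" where
  "code = map (\<lambda>b. if b then Two else One)"

text \<open>\<open>VW3\<close> makes the empty word an initial segment of every standard word,
  whereas \<open>WD3\<close> admits only nonempty ones; hence the exclusion of \<open>vw_e\<close>.
  Constants take no arguments, so variable 0 is their value.\<close>

definition wd_in_vw :: "(bool list, wd_rel, vw_fun, vw_rel) translation" where
  "wd_in_vw = \<lparr>dom_tr = Neg Bot,
     fun_tr = (\<lambda>s. Var 0 \<^bold>= canon (code s)),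
     rel_tr = (\<lambda>r. case r of
       Wd_le \<Rightarrow> vw_init (Var 0) (Var 1) \<^bold>\<and> Neg (Var 0 \<^bold>= vw_e)
     | Wd_C \<Rightarrow> wd_C_fm)\<rparr>"

lemma wf_fits_fm: "wf_fm vw_sig (fits_fm n x y)"
  by (simp add: fits_fm_def)

lemma fv_fits_fm: "fv_fm (fits_fm n x y) = {n, x, y}"
  by (auto simp: fits_fm_def)

lemma wf_conc_fm: "wf_fm vw_sig (conc_fm x y z)"
  by (simp add: conc_fm_def tally_fm_def wf_fits_fm)

lemma fv_conc_fm: "fv_fm (conc_fm x y z) = {x, y, z}"
  by (auto simp: conc_fm_def tally_fm_def fv_fits_fm)

lemma all_wd_rel: "(\<forall>r. P r) \<longleftrightarrow> P Wd_le \<and> P Wd_C"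
  by (metis wd_rel.exhaust)

lemma wf_wd_in_vw: "wf_translation wd_sig vw_sig wd_in_vw"
proof -
  have "wf_fm vw_sig wd_C_fm" "fv_fm wd_C_fm \<subseteq> {..<3}"
    by (auto simp: wd_C_fm_def unique_conc_fm_def wf_conc_fm fv_conc_fm)
  then show ?thesis
    by (auto simp: wf_translation_def wd_in_vw_def all_wd_rel split: if_splits)
qed

lemma prefix_twos: "prefix s (twos m) \<longleftrightarrow> (\<exists>k\<le>m. s = twos k)"
proof
  assume p: "prefix s (twos m)"
  then have "length s \<le> m" using prefix_length_le[OF p] by simp
  moreover have "twos (length s) = s"
    using set_mono_prefix[OF p] by (intro replicate_length_same) auto
  ultimately show "\<exists>k\<le>m. s = twos k" by metis
next
  assume "\<exists>k\<le>m. s = twos k"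
  then show "prefix s (twos m)" by (auto simp: prefix_def le_iff_add replicate_add)
qed

text \<open>The marker \<open>One\<close> cannot lie inside the final block of \<open>Two\<close>s, so the blocks do not overlap.\<close>

lemma marked_length:
  assumes "prefix (twos i @ [One]) v" "prefix (twos j) (rev v)"
  shows "i + j < length v"
proof -
  from assms(1) obtain q where v: "v = twos i @ [One] @ q" by (auto simp: prefix_def)
  have "j \<le> length q"
  proof (rule ccontr)
    assume j: "\<not> j \<le> length q"
    then have "twos j ! length q = rev v ! length q"
      using assms(2) by (auto simp: prefix_def nth_append)
    with j show False by (simp add: v nth_append)
  qed
  then show ?thesis by (simp add: v)
qed

section \<open>Standard words inside an arbitrary model\<close>

locale vw_model =
  fixes U :: "'u set" and F :: "vw_fun \<Rightarrow> 'u list \<Rightarrow> 'u" and R :: "vw_rel \<Rightarrow> 'u list \<Rightarrow> bool"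
    and e :: "nat \<Rightarrow> 'u"
  assumes is_structure: "is_structure vw_sig U F"
    and sat_VW: "\<gamma> \<in> VW_plus \<Longrightarrow> sat U F R e \<gamma>"
begin

definition "c w = foldl (\<lambda>x d. F (Vw_S d) [x]) (F Vw_e []) w"

abbreviation "suc d x \<equiv> F (Vw_S d) [x]"
abbreviation "reversal x \<equiv> F Vw_f [x]"
abbreviation "init x y \<equiv> R Vw_init [x, y]"
abbreviation "len x y \<equiv> R Vw_len [x, y]"

lemma c_simps: "c [] = F Vw_e []" "c (w @ [d]) = suc d (c w)"
  by (simp_all add: c_def)

lemma eval_canon [simp]: "eval F e' (canon w) = c w"
  by (induction w rule: rev_induct) (simp_all add: canon_simps c_simps)

lemma c_in: "c w \<in> U"
proof (induction w rule: rev_induct)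
  case Nil
  then show ?case using is_structure by (simp add: is_structure_def c_simps)
next
  case (snoc d w)
  then show ?case using is_structure
    by (simp add: is_structure_def c_simps)
qed

lemma c_eq: "c s = c t \<longleftrightarrow> s = t"
  using sat_VW[OF VW1, of s t] by auto

text \<open>\<open>VW3\<close> and \<open>VW4\<close> settle the empty word, and \<open>VW5\<close>
  adds one letter at a time. Thus a standard word has no nonstandard initial segment.\<close>

lemma init_c: "x \<in> U \<Longrightarrow> init x (c t) \<longleftrightarrow> (\<exists>s. prefix s t \<and> x = c s)"
proof (induction t rule: rev_induct)
  case Nil
  then show ?case using sat_VW[OF VW3, of "[]"] sat_VW[OF VW4] by (auto simp: c_simps(1))
next
  case (snoc d t)
  then show ?case using sat_VW[OF VW5, of d t] by (auto simp: c_simps(2))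
qed

lemma init_c_c: "init (c s) (c t) \<longleftrightarrow> prefix s t"
  using init_c[OF c_in] c_eq by auto

lemma len_c: "x \<in> U \<Longrightarrow> len x (c (twos m)) \<longleftrightarrow> (\<exists>s. length s \<le> m \<and> x = c s)"
  using sat_VW[OF VW6, of m] by (auto simp: sat_Disj set_words_upto)

lemma len_c_c: "len (c s) (c (twos m)) \<longleftrightarrow> length s \<le> m"
  using len_c[OF c_in] c_eq by auto

lemma reversal_c: "reversal (c t) = c (rev t)"
  using sat_VW[OF VW8, of t] by simp

definition "tally n \<longleftrightarrow> init (c []) n \<and> (\<forall>u\<in>U. init u n \<longrightarrow> u \<noteq> n \<longrightarrow> init (suc Two u) n)"

definition "fits n x y \<longleftrightarrow> (\<exists>a\<in>U. \<exists>b\<in>U. \<exists>v\<in>U. init a n \<and> init b n \<and> len v n \<and>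
  len x a \<and> len y (suc Two b) \<and> init (suc One a) v \<and> init b (reversal v))"

definition "conc x y z \<longleftrightarrow> (\<exists>n\<in>U. tally n \<and> fits n x y \<and> len z n \<and> init x z \<and>
  init (reversal y) (reversal z) \<and> (\<forall>m\<in>U. init m n \<longrightarrow> m \<noteq> n \<longrightarrow> \<not> fits m x y \<and> \<not> len z m))"

definition "unique_conc x y z \<longleftrightarrow> conc x y z \<and> (\<forall>z'\<in>U. conc x y z' \<longrightarrow> z' = z)"

lemma sat_tally_fm: "sat U F R e' (tally_fm n) \<longleftrightarrow> tally (e' n)"
  by (auto simp: tally_fm_def tally_def c_simps)

lemma sat_fits_fm: "sat U F R e' (fits_fm n x y) \<longleftrightarrow> fits (e' n) (e' x) (e' y)"
  by (auto simp: fits_fm_def fits_def numeral_2_eq_2 numeral_3_eq_3)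

lemma sat_conc_fm: "sat U F R e' (conc_fm x y z) \<longleftrightarrow> conc (e' x) (e' y) (e' z)"
  by (auto simp: conc_fm_def conc_def sat_tally_fm sat_fits_fm numeral_2_eq_2)

lemma sat_unique_conc_fm:
  "sat U F R e' (unique_conc_fm x y z) \<longleftrightarrow> unique_conc (e' x) (e' y) (e' z)"
  by (auto simp: unique_conc_fm_def unique_conc_def sat_conc_fm)

text \<open>External induction: a nonstandard tally lies above all standard ones.\<close>

lemma tally_cases:
  assumes "tally n"
  shows "(\<exists>k<m. n = c (twos k)) \<or> init (c (twos m)) n"
proof (induction m)
  case 0
  with assms show ?case by (simp add: tally_def)
next
  case (Suc m)
  show ?case
  proof (cases "init (c (twos m)) n \<and> c (twos m) \<noteq> n")
    case True
    then have "init (suc Two (c (twos m))) n" using assms c_in by (simp add: tally_def)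
    then show ?thesis using c_simps(2)[of "twos m" Two] by (simp add: replicate_append_same)
  next
    case False
    with Suc show ?thesis using less_Suc_eq by metis
  qed
qed

lemma tally_twos: "tally (c (twos m))"
proof -
  have "init (suc Two u) (c (twos m))" if "u \<in> U" "init u (c (twos m))" "u \<noteq> c (twos m)" for u
  proof -
    from that obtain k where k: "k \<le> m" "u = c (twos k)" by (auto simp: init_c prefix_twos)
    with that(3) have "Suc k \<le> m" by (cases "k = m") auto
    moreover have "suc Two u = c (twos (Suc k))"
      using c_simps(2)[of "twos k" Two] k by (simp add: replicate_append_same)
    ultimately show ?thesis using prefix_twos by (auto simp: init_c_c)
  qed
  then show ?thesis by (simp add: tally_def init_c_c)
qed

text \<open>Below a standard tally all witnesses are standard. If they are the blocks of lengths
  \<open>i\<close> and \<open>j\<close> and the word \<open>w\<close>, then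
  \<open>length s \<le> i\<close>, \<open>length t \<le> j + 1\<close> and
  \<open>i + j < length w \<le> m\<close>, which bounds the sum.\<close>

lemma fits_c:
  assumes "t \<noteq> []"
  shows "fits (c (twos m)) (c s) (c t) \<longleftrightarrow> length s + length t \<le> m"
proof
  assume "fits (c (twos m)) (c s) (c t)"
  then obtain a b v where abv: "a \<in> U" "b \<in> U" "v \<in> U" "init a (c (twos m))" "init b (c (twos m))"
    "len v (c (twos m))" "len (c s) a" "len (c t) (suc Two b)" "init (suc One a) v"
    "init b (reversal v)" by (auto simp: fits_def)
  then obtain i j w where w: "a = c (twos i)" "b = c (twos j)" "v = c w" "length w \<le> m"
    by (auto simp: init_c prefix_twos len_c)
  have "suc Two b = c (twos (Suc j))"
    using c_simps(2)[of "twos j" Two] w by (simp add: replicate_append_same)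
  then have "length s \<le> i" "length t \<le> Suc j" using abv w by (simp_all only: len_c_c)
  moreover have "prefix (twos i @ [One]) w" "prefix (twos j) (rev w)"
    using abv w by (simp_all add: c_simps(2)[symmetric] init_c_c reversal_c)
  then have "i + j < length w" by (rule marked_length)
  ultimately show "length s + length t \<le> m" using w(4) by simp
next
  assume m: "length s + length t \<le> m"
  obtain j where j: "length t = Suc j" using assms by (cases t) auto
  let ?i = "length s"
  \<comment> \<open>Nonemptiness of \<open>t\<close> allows the final block to be one shorter than
    \<open>t\<close>. The marker takes up the spare place, and the total length is exactly
    \<open>length s + length t\<close>.\<close>
  let ?v = "twos ?i @ [One] @ twos j"
  have "suc Two (c (twos j)) = c (twos (Suc j))" "suc One (c (twos ?i)) = c (twos ?i @ [One])"
    using c_simps(2)[of "twos j" Two] c_simps(2)[of "twos ?i" One]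
    by (simp_all add: replicate_append_same)
  moreover have "prefix (twos ?i) (twos m)" "prefix (twos j) (twos m)"
    using m j by (auto simp: prefix_twos)
  ultimately show "fits (c (twos m)) (c s) (c t)"
    unfolding fits_def using m j
    by (intro bexI[of _ "c (twos ?i)"] bexI[of _ "c (twos j)"] bexI[of _ "c ?v"] c_in)
       (simp_all add: init_c_c len_c_c reversal_c del: replicate.simps)
qed

lemma conc_c:
  assumes "t \<noteq> []" "z \<in> U"
  shows "conc (c s) (c t) z \<longleftrightarrow> z = c (s @ t)"
proof
  let ?m = "length s + length t"
  assume "conc (c s) (c t) z"
  then obtain n where n: "n \<in> U" "tally n" "fits n (c s) (c t)" "len z n" "init (c s) z"
    "init (reversal (c t)) (reversal z)"
    and least: "\<And>k. k \<in> U \<Longrightarrow> init k n \<Longrightarrow> k \<noteq> n \<Longrightarrow> \<not> fits k (c s) (c t) \<and> \<not> len z k"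
    by (auto simp: conc_def)
  \<comment> \<open>A standard tally below \<open>?m\<close> cannot fit, by \<open>fits_c\<close>.
    Every other tally, standard or not, has \<open>twos ?m\<close> as an initial segment.\<close>
  have "init (c (twos ?m)) n"
    using tally_cases[OF n(2), of ?m] n(3) fits_c[OF assms(1)] by fastforce
  \<comment> \<open>The block \<open>twos ?m\<close> itself fits, so minimality leaves no room for a
    larger or nonstandard \<open>n\<close>.\<close>
  then have n_eq: "n = c (twos ?m)"
    using least[of "c (twos ?m)"] c_in fits_c[OF assms(1)] by auto
  then obtain w where w: "z = c w" "length w \<le> ?m" using n(4) assms(2) len_c by auto
  \<comment> \<open>A shorter \<open>w\<close> would be bounded by the smaller tally
    \<open>twos (length w)\<close>, against the second half of minimality.\<close>
  have "\<not> length w < ?m"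
  proof
    assume "length w < ?m"
    then show False
      using least[of "c (twos (length w))"] c_in
      by (auto simp: n_eq w init_c_c len_c_c prefix_twos c_eq)
  qed
  with w have len_w: "length w = ?m" by simp
  have "prefix s w" "prefix (rev t) (rev w)"
    using n by (simp_all add: w reversal_c init_c_c)
  then obtain p q where "w = s @ p" "w = q @ t"
    by (auto simp: prefix_def) (metis rev_append rev_rev_ident)
  \<comment> \<open>The initial piece \<open>s\<close> and the final piece \<open>t\<close> have
    lengths adding up to that of \<open>w\<close>, so they meet without gap or overlap.\<close>
  with len_w have "w = s @ t" by auto
  with w show "z = c (s @ t)" by simp
next
  let ?m = "length s + length t"
  assume z: "z = c (s @ t)"
  have "\<not> fits k (c s) (c t) \<and> \<not> len z k"
    if "k \<in> U" "init k (c (twos ?m))" "k \<noteq> c (twos ?m)" for k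
  proof -
    from that obtain i where i: "i \<le> ?m" "k = c (twos i)" by (auto simp: init_c prefix_twos)
    with that(3) have "i < ?m" by (cases "i = ?m") auto
    then show ?thesis using fits_c[OF assms(1)] by (simp add: i z len_c_c)
  qed
  then show "conc (c s) (c t) z"
    unfolding conc_def using fits_c[OF assms(1), of ?m s]
    by (intro bexI[of _ "c (twos ?m)"] c_in)
       (simp_all add: z tally_twos len_c_c init_c_c reversal_c)
qed

section \<open>The defined model of \<open>WD_R\<close>\<close>

definition "wd_fun s xs = c (code s)"
definition "wd_rel r xs \<longleftrightarrow> (case r of
    Wd_le \<Rightarrow> init (xs ! 0) (xs ! 1) \<and> xs ! 0 \<noteq> c []
  | Wd_C \<Rightarrow> unique_conc (xs ! 0) (xs ! 1) (xs ! 2) \<or>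
      \<not> (\<exists>z\<in>U. unique_conc (xs ! 0) (xs ! 1) z) \<and> xs ! 2 = xs ! 0)"

lemma translated: "translated_structure wd_sig wd_in_vw U F R U wd_fun wd_rel"
proof
  show "is_structure wd_sig U wd_fun"
    using c_in by (auto simp: is_structure_def wd_fun_def)
  show "sat U F R e' (dom_tr wd_in_vw) \<longleftrightarrow> e' 0 \<in> U" if "e' 0 \<in> U" for e'
    using that by (simp add: wd_in_vw_def)
  show "sat U F R (append_env xs (case_nat a e')) (fun_tr wd_in_vw s) \<longleftrightarrow> a = wd_fun s xs"
    if "fun_arity wd_sig s = Some (length xs)" for s xs a e'
    using that by (auto simp: wd_in_vw_def wd_fun_def split: if_splits)
  show "sat U F R (append_env xs e') (rel_tr wd_in_vw r) \<longleftrightarrow> wd_rel r xs"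
    if "rel_arity wd_sig r = Some (length xs)" for r xs e'
    using that
    by (cases r) (auto simp: wd_in_vw_def wd_rel_def wd_C_fm_def sat_unique_conc_fm
      append_env_def numeral_2_eq_2 c_simps)
qed simp

lemma code_simps: "code (s @ t) = code s @ code t" "code s = [] \<longleftrightarrow> s = []"
  by (simp_all add: code_def)

lemma inj_code: "code s = code t \<longleftrightarrow> s = t"
proof -
  have "inj (\<lambda>b. if b then Two else One)" by (auto simp: inj_def split: if_splits)
  then show ?thesis unfolding code_def by (simp add: inj_map_eq_map)
qed

lemma prefix_code: "prefix w (code t) \<longleftrightarrow> (\<exists>s. prefix s t \<and> w = code s)"
  unfolding code_def by (auto simp: prefix_def map_eq_append_conv append_eq_map_conv)

lemma unique_conc_code:
  assumes "t \<noteq> []"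
  shows "unique_conc (c (code s)) (c (code t)) (c (code (s @ t)))"
  using assms conc_c[of "code t"] c_in by (auto simp: unique_conc_def code_simps)

lemma sat_WD_R:
  assumes "\<phi> \<in> WD_R"
  shows "sat U wd_fun wd_rel e' \<phi>"
  using assms
proof cases
  case (WD1 s t)
  then show ?thesis using unique_conc_code by (simp add: wd_rel_def wd_fun_def)
next
  case (WD2 s t)
  then show ?thesis by (simp add: wd_fun_def c_eq inj_code)
next
  case (WD3 t)
  have "init x (c (code t)) \<and> x \<noteq> c [] \<longleftrightarrow> (\<exists>s. s \<noteq> [] \<and> prefix s t \<and> x = c (code s))"
    if "x \<in> U" for x
    using that by (auto simp: init_c prefix_code c_eq code_simps)
  then show ?thesis unfolding WD3
    by (auto simp: wd_rel_def wd_fun_def sat_Disj set_wd_initial)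
next
  case WD4
  \<comment> \<open>The witness is the unique concatenation if there is one, and \<open>x\<close>
    otherwise.\<close>
  then show ?thesis by (auto simp: wd_rel_def numeral_2_eq_2)
next
  case WD5
  \<comment> \<open>Which disjunct applies depends only on \<open>x\<close> and \<open>y\<close>, so
    it is the same for \<open>u\<close> and \<open>v\<close>; the default makes both equal to
    \<open>x\<close>.\<close>
  have "u = v" if C: "wd_rel Wd_C [x, y, u]" "wd_rel Wd_C [x, y, v]" and "u \<in> U" "v \<in> U" for x y u v
  proof (cases "\<exists>z\<in>U. unique_conc x y z")
    case True
    with C have "unique_conc x y u" "unique_conc x y v" by (simp_all add: wd_rel_def)
    then show ?thesis using \<open>u \<in> U\<close> unfolding unique_conc_def by blast
  next
    case False
    with that show ?thesis by (auto simp: wd_rel_def)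
  qed
  then show ?thesis unfolding WD5
    by (auto simp: numeral_2_eq_2 numeral_3_eq_3)
qed

end

theorem mainTheorem6: "interprets vw_sig VW_plus wd_sig WD_R"
proof (rule interpretsI[OF wf_wd_in_vw VW_plus_sentence WD_R_sentence])
  fix U :: "vw_fun tm set set" and F R e
  assume "is_structure vw_sig U F" "\<And>\<gamma>. \<gamma> \<in> VW_plus \<Longrightarrow> sat U F R e \<gamma>"
  then interpret vw_model U F R e by unfold_locales
  show "\<exists>U' F' R'. translated_structure wd_sig wd_in_vw U F R U' F' R' \<and>
      (\<forall>\<phi>\<in>WD_R. sat U' F' R' e \<phi>)"
    using translated sat_WD_R by blast
qed

end
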